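(* Let $G,H$ be Polish groups and $0<\alpha<\omega_1$. If $G$ is $\alpha$-unbalanced but $H$ is not $\alpha$-unbalanced, then $E(G)\not\le_B E(H)$.
   Context: For a Polish group $G$, $E(G)$ is the equivalence relation on $G^\omega$ given by $x\,E(G)\,y$ iff $(x(n)y(n)^{-1})_n$ converges in $G$. Let $c(G)\subseteq G^\omega$ be the group (pointwise operations) of all convergent sequences in $G$, topologized by the supremum metric $d_u(x,y)=\sup_n d(x(n),y(n))$ for a compatible complete metric $d$ on $G$; it is a Polish group acting continuously on $G^\omega$ (product topology) by left multiplication $(\gamma x)(n)=\gamma(n)x(n)$, and $E(G)$ is the orbit equivalence relation of this action. For a Polish group $K$ acting continuously on a Polish space $X$, an open neighborhood $V$ of $1_K$ and $\alpha<\omega_1$, define $\leftrightsquigarrow_V^\alpha$ by induction: $x\leftrightsquigarrow_V^0 y$ iff $y\in\overline{Vx}$ and $x\in\overline{Vy}$; for $\alpha>0$, $x\leftrightsquigarrow_V^\alpha y$ iff for every open $W\ni 1_K$ and every open $U\subseteq X$ containing $x$ or $y$ there are $g^x,g^y\in V$ with $g^xx,g^yy\in U$ and $g^xx\leftrightsquigarrow_W^\beta g^yy$ for all $\beta<\alpha$. A Polish group $G$ is $\alpha$-unbalanced if there are $x,y\in G^\omega$ with $x\leftrightsquigarrow_{c(G)}^\alpha y$ (for the left multiplication action of $c(G)$ on $G^\omega$) and $(x,y)\notin E(G)$. $\le_B$ denotes Borel reducibility. *)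

theory Defs
  imports "HOL-Analysis.Analysis"
begin

text \<open>
  A Polish group is a type of class \<open>{topological_group_add, polish_space}\<close>. The class
  \<open>group_add\<close> is not commutative, so this covers all Polish groups, written additively:
  \<open>x + y\<close>, \<open>- x\<close>, \<open>0\<close> and \<open>x - y\<close> stand for \<open>xy\<close>, \<open>x\<inverse>\<close>, \<open>1\<close> and \<open>xy\<inverse>\<close>. The class
  \<open>polish_space\<close> comes with \<open>dist\<close>, an arbitrary compatible complete metric.
  The topology on \<open>nat \<Rightarrow> 'g\<close> is the product topology.
\<close>

text \<open>\<open>cardSuc natLeq\<close> is the initial well-order of the successor cardinal of \<open>\<aleph>\<^sub>0\<close>.\<close>

typedef omega1 = "Field (cardSuc natLeq)"
proof -
  have "infinite (Field (cardSuc natLeq))"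
    using cardSuc_finite[OF natLeq_Card_order] by (simp add: Field_natLeq)
  then show ?thesis
    by (metis ex_in_conv finite.emptyI)
qed

lemma Well_order_cardSuc_natLeq: "Well_order (cardSuc natLeq)"
  by (rule cardSuc_Well_order[OF natLeq_Card_order])

instantiation omega1 :: wellorder
begin

definition less_eq_omega1 :: "omega1 \<Rightarrow> omega1 \<Rightarrow> bool"
  where "\<alpha> \<le> \<beta> \<longleftrightarrow> (Rep_omega1 \<alpha>, Rep_omega1 \<beta>) \<in> cardSuc natLeq"

definition less_omega1 :: "omega1 \<Rightarrow> omega1 \<Rightarrow> bool"
  where "(\<alpha>::omega1) < \<beta> \<longleftrightarrow> \<alpha> \<le> \<beta> \<and> \<alpha> \<noteq> \<beta>"

instance
proof -
  let ?r = "cardSuc natLeq"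
  have lin: "Linear_order ?r" and wf: "wf (?r - Id)"
    using Well_order_cardSuc_natLeq by (auto simp: well_order_on_def)
  have refl: "Refl ?r" and trans: "trans ?r" and antisym: "antisym ?r" and tot: "Total ?r"
    using lin by (auto simp: order_on_defs)
  have le_refl: "\<alpha> \<le> \<alpha>" for \<alpha> :: omega1
    using refl Rep_omega1 by (auto simp: less_eq_omega1_def refl_on_def)
  have le_antisym: "\<alpha> = \<beta>" if "\<alpha> \<le> \<beta>" "\<beta> \<le> \<alpha>" for \<alpha> \<beta> :: omega1
    using that antisymD[OF antisym] by (metis less_eq_omega1_def Rep_omega1_inject)
  have le_trans: "\<alpha> \<le> \<gamma>" if "\<alpha> \<le> \<beta>" "\<beta> \<le> \<gamma>" for \<alpha> \<beta> \<gamma> :: omega1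
    using that trans by (auto simp: less_eq_omega1_def dest: transD)
  have le_total: "\<alpha> \<le> \<beta> \<or> \<beta> \<le> \<alpha>" for \<alpha> \<beta> :: omega1
    using tot le_refl[of \<alpha>] Rep_omega1[of \<alpha>] Rep_omega1[of \<beta>]
    unfolding less_eq_omega1_def total_on_def by (metis Rep_omega1_inject)
  have ind: "P \<alpha>" if step: "\<And>\<alpha>. (\<And>\<beta>. \<beta> < \<alpha> \<Longrightarrow> P \<beta>) \<Longrightarrow> P \<alpha>"
    for P :: "omega1 \<Rightarrow> bool" and \<alpha>
  proof -
    have "wf (inv_image (?r - Id) Rep_omega1)"
      by (rule wf_inv_image[OF wf])
    then show ?thesis
    proof (induction \<alpha> rule: wf_induct_rule)
      case (less \<alpha>)
      show ?case
        by (rule step, rule less)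
          (auto simp: less_omega1_def less_eq_omega1_def Rep_omega1_inject)
    qed
  qed
  show "OFCLASS(omega1, wellorder_class)"
  proof
    fix P :: "omega1 \<Rightarrow> bool" and \<alpha>
    assume "\<And>\<alpha>. (\<And>\<beta>. \<beta> < \<alpha> \<Longrightarrow> P \<beta>) \<Longrightarrow> P \<alpha>"
    then show "P \<alpha>"
      by (rule ind)
  qed (use le_refl le_antisym le_trans le_total in \<open>auto simp: less_omega1_def\<close>)
qed

end

instantiation omega1 :: zero
begin

definition zero_omega1 :: omega1
  where "0 = (LEAST \<alpha>::omega1. True)"

instance ..

end

lemma omega1_zero_le: "0 \<le> \<alpha>" for \<alpha> :: omega1
  unfolding zero_omega1_def by (rule Least_le) simp

lemma countable_iff_ordLeq_natLeq:
  includes cardinal_syntax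
  shows "countable A \<longleftrightarrow> |A| \<le>o natLeq"
proof -
  have "countable A \<longleftrightarrow> |A| \<le>o |UNIV :: nat set|"
    unfolding countable_def card_of_ordLeq[symmetric] by simp
  also have "\<dots> \<longleftrightarrow> |A| \<le>o natLeq"
    using card_of_nat ordIso_symmetric ordLeq_ordIso_trans by blast
  finally show ?thesis .
qed

lemma countable_lessThan_omega1:
  includes cardinal_syntax
  fixes \<alpha> :: omega1
  shows "countable {..<\<alpha>}"
proof -
  let ?r = "cardSuc natLeq"
  have "|underS ?r (Rep_omega1 \<alpha>)| <o ?r"
    by (rule card_of_underS[OF cardSuc_Card_order[OF natLeq_Card_order] Rep_omega1])
  then have "|underS ?r (Rep_omega1 \<alpha>)| \<le>o natLeq"
    using cardSuc_ordLess_ordLeq cardSuc_ordLeq_ordLess[OF natLeq_Card_order card_of_Card_order]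
    by blast
  then have "countable (underS ?r (Rep_omega1 \<alpha>))"
    by (simp add: countable_iff_ordLeq_natLeq)
  moreover have "Rep_omega1 ` {..<\<alpha>} \<subseteq> underS ?r (Rep_omega1 \<alpha>)"
    by (auto simp: underS_def less_omega1_def less_eq_omega1_def Rep_omega1_inject)
  ultimately have "countable (Rep_omega1 ` {..<\<alpha>})"
    by (rule countable_subset[rotated])
  then show ?thesis
    by (rule countable_image_inj_on) (auto simp: inj_on_def Rep_omega1_inject)
qed

lemma uncountable_omega1:
  includes cardinal_syntax
  shows "uncountable (UNIV :: omega1 set)"
proof
  assume "countable (UNIV :: omega1 set)"
  then have "countable (range Rep_omega1)"
    by simp
  then have "countable (Field (cardSuc natLeq))"
    using type_definition.Rep_range[OF type_definition_omega1] by simp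
  then have "|Field (cardSuc natLeq)| \<le>o natLeq"
    by (simp add: countable_iff_ordLeq_natLeq)
  then have "cardSuc natLeq \<le>o natLeq"
    using card_of_Field_ordIso[OF cardSuc_Card_order[OF natLeq_Card_order]]
      ordIso_ordLeq_trans ordIso_symmetric by blast
  then show False
    using cardSuc_greater[OF natLeq_Card_order] not_ordLess_ordLeq by blast
qed

definition borel_reducible ::
  "('a::topological_space \<Rightarrow> 'a \<Rightarrow> bool) \<Rightarrow> ('b::topological_space \<Rightarrow> 'b \<Rightarrow> bool) \<Rightarrow> bool"
  (infix "\<le>\<^sub>B" 50)
  where "E \<le>\<^sub>B F \<longleftrightarrow> (\<exists>f \<in> borel \<rightarrow>\<^sub>M borel. \<forall>x y. E x y \<longleftrightarrow> F (f x) (f y))"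

definition E_rel ::
  "(nat \<Rightarrow> 'g::{topological_group_add, polish_space}) \<Rightarrow> (nat \<Rightarrow> 'g) \<Rightarrow> bool"
  where "E_rel x y \<longleftrightarrow> convergent (\<lambda>n. x n - y n)"

definition cseq :: "(nat \<Rightarrow> 'g::{topological_group_add, polish_space}) set"
  where "cseq = {\<gamma>. convergent \<gamma>}"

text \<open>The value 0 outside \<open>cseq\<close> is a dummy: \<open>Metric_space\<close> requires nonnegativity everywhere.\<close>

definition dist_u ::
  "(nat \<Rightarrow> 'g::{topological_group_add, polish_space}) \<Rightarrow> (nat \<Rightarrow> 'g) \<Rightarrow> real"
  where "dist_u x y = (if x \<in> cseq \<and> y \<in> cseq then SUP n. dist (x n) (y n) else 0)"

definition cseq_topology :: "(nat \<Rightarrow> 'g::{topological_group_add, polish_space}) topology"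
  where "cseq_topology = Metric_space.mtopology cseq dist_u"

definition cseq_act ::
  "(nat \<Rightarrow> 'g::{topological_group_add, polish_space}) \<Rightarrow> (nat \<Rightarrow> 'g) \<Rightarrow> nat \<Rightarrow> 'g"
  where "cseq_act \<gamma> x = (\<lambda>n. \<gamma> n + x n)"

lemma bdd_above_dist_cseq:
  assumes "x \<in> cseq" "y \<in> cseq"
  shows "bdd_above (range (\<lambda>n. dist (x n) (y n)))"
proof -
  have "bounded (range x)" "bounded (range y)"
    using assms by (auto simp: cseq_def convergent_imp_bounded convergent_def)
  then have "bounded (range x \<union> range y)"
    by simp
  then obtain e where "\<forall>u\<in>range x \<union> range y. \<forall>v\<in>range x \<union> range y. dist u v \<le> e"
    using bounded_two_points by metis
  then show ?thesis
    by (intro bdd_aboveI[of _ e]) auto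
qed

lemma Metric_space_cseq: "Metric_space cseq dist_u"
proof
  show nonneg: "0 \<le> dist_u x y" for x y :: "nat \<Rightarrow> 'a"
    unfolding dist_u_def
    by (auto intro!: cSUP_upper2[OF bdd_above_dist_cseq, of _ _ 0])
  show "dist_u x y = dist_u y x" for x y :: "nat \<Rightarrow> 'a"
    by (auto simp: dist_u_def dist_commute)
  have upper: "dist (x n) (y n) \<le> dist_u x y"
    if "x \<in> cseq" "y \<in> cseq" for x y :: "nat \<Rightarrow> 'a" and n
    using that by (auto simp: dist_u_def intro: cSUP_upper bdd_above_dist_cseq)
  show "dist_u x y = 0 \<longleftrightarrow> x = y" if "x \<in> cseq" "y \<in> cseq" for x y :: "nat \<Rightarrow> 'a"
  proof
    assume "dist_u x y = 0"
    then have "dist (x n) (y n) \<le> 0" for n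
      using upper[OF that, of n] by simp
    then show "x = y"
      by (intro ext) simp
  next
    assume "x = y"
    then show "dist_u x y = 0"
      by (simp add: dist_u_def)
  qed
  show "dist_u x z \<le> dist_u x y + dist_u y z"
    if "x \<in> cseq" "y \<in> cseq" "z \<in> cseq" for x y z :: "nat \<Rightarrow> 'a"
  proof -
    have "dist (x n) (z n) \<le> dist_u x y + dist_u y z" for n
      using dist_triangle[of "x n" "z n" "y n"] upper[OF that(1,2), of n] upper[OF that(2,3), of n]
      by linarith
    then have "(SUP n. dist (x n) (z n)) \<le> dist_u x y + dist_u y z"
      by (intro cSUP_least) auto
    then show ?thesis
      using that by (simp add: dist_u_def)
  qed
qed

lemma topspace_cseq_topology: "topspace cseq_topology = cseq"
  unfolding cseq_topology_def by (rule Metric_space.topspace_mtopology[OF Metric_space_cseq])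

lemma E_rel_iff_orbit: "E_rel x y \<longleftrightarrow> (\<exists>\<gamma>\<in>cseq. x = cseq_act \<gamma> y)"
proof
  assume "E_rel x y"
  then show "\<exists>\<gamma>\<in>cseq. x = cseq_act \<gamma> y"
    by (intro bexI[of _ "\<lambda>n. x n - y n"]) (auto simp: E_rel_def cseq_def cseq_act_def)
next
  assume "\<exists>\<gamma>\<in>cseq. x = cseq_act \<gamma> y"
  then show "E_rel x y"
    by (auto simp: E_rel_def cseq_def cseq_act_def)
qed

text \<open>
  \<open>usq K e act \<alpha> V x y\<close> is \<open>x \<leftrightsquigarrow>\<^sub>V\<^sup>\<alpha> y\<close>, for the group with topology \<open>K\<close> (on the carrier
  \<open>topspace K\<close>) and identity \<open>e\<close> acting by \<open>act\<close>.
\<close>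

function usq ::
  "'k topology \<Rightarrow> 'k \<Rightarrow> ('k \<Rightarrow> 'x::topological_space \<Rightarrow> 'x) \<Rightarrow> omega1 \<Rightarrow> 'k set \<Rightarrow> 'x \<Rightarrow> 'x \<Rightarrow> bool"
  where
  "usq K e act \<alpha> V x y \<longleftrightarrow>
    (if \<alpha> = 0
     then y \<in> closure ((\<lambda>g. act g x) ` V) \<and> x \<in> closure ((\<lambda>g. act g y) ` V)
     else \<forall>W U. openin K W \<and> e \<in> W \<and> open U \<and> (x \<in> U \<or> y \<in> U) \<longrightarrow>
       (\<exists>gx\<in>V. \<exists>gy\<in>V. act gx x \<in> U \<and> act gy y \<in> U \<and>
         (\<forall>\<beta>. \<beta> < \<alpha> \<longrightarrow> usq K e act \<beta> W (act gx x) (act gy y))))"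
  by pat_completeness auto
termination
  by (relation "inv_image {(\<beta>::omega1, \<alpha>). \<beta> < \<alpha>} (\<lambda>(K, e, act, \<alpha>, V, x, y). \<alpha>)")
    (auto intro: wf)

declare usq.simps [simp del]

definition unbalanced :: "omega1 \<Rightarrow> 'g::{topological_group_add, polish_space} itself \<Rightarrow> bool"
  where "unbalanced \<alpha> (_ :: 'g itself) \<longleftrightarrow>
    (\<exists>x y :: nat \<Rightarrow> 'g. usq cseq_topology (\<lambda>_. 0) cseq_act \<alpha> cseq x y \<and> \<not> E_rel x y)"

end

theory Submission
  imports Defs
begin

text \<open>
  Let \<open>f\<close> be a Borel reduction. On a comeager set \<open>C\<close> the map \<open>f\<close> is continuous and satisfies
  Hjorth's orbit continuity: for every neighbourhood \<open>W\<close> of the identity of \<open>c(H)\<close>, locally uniformly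
  in \<open>x \<in> C\<close>, there is a neighbourhood \<open>V\<close> of the identity of \<open>c(G)\<close> with \<open>f(gx) \<in> W f(x)\<close> for
  generic \<open>g \<in> V\<close>. By induction on \<open>\<alpha>\<close>, choosing the group elements in the definition of
  \<open>\<leftrightsquigarrow>\<^sub>V\<^sup>\<alpha>\<close> generically so that all points stay in \<open>C\<close>, the map \<open>f\<close> transports
  \<open>x \<leftrightsquigarrow>\<^sub>V\<^sup>\<alpha> y\<close> to \<open>f(x) \<leftrightsquigarrow>\<^sub>W\<^sup>\<alpha> f(y)\<close> for \<open>x, y \<in> C\<close>. A pair witnessing that \<open>G\<close> is
  \<open>\<alpha>\<close>-unbalanced need not lie in \<open>C\<close>, but right multiplication by any \<open>z \<in> G\<^sup>\<omega>\<close> commutes with the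
  action of \<open>c(G)\<close>, so \<open>(xz, yz)\<close> is again a witness, and for generic \<open>z\<close> both points are in \<open>C\<close>.
\<close>

subsection \<open>Baire category\<close>

definition dense_open :: "'a::topological_space set \<Rightarrow> bool"
  where "dense_open S \<longleftrightarrow> open S \<and> (\<forall>T. open T \<longrightarrow> T \<noteq> {} \<longrightarrow> S \<inter> T \<noteq> {})"

text \<open>A countable family instead of a sequence of sets, so that the families of countably many
  sets are merged by a plain union in \<open>comeager_INT\<close>.\<close>

definition comeager :: "'a::topological_space set \<Rightarrow> bool"
  where "comeager A \<longleftrightarrow> (\<exists>F. countable F \<and> (\<forall>S\<in>F. dense_open S) \<and> (\<forall>x. (\<forall>S\<in>F. x \<in> S) \<longrightarrow> x \<in> A))"

text \<open>Written as a filter, \<open>\<forall>\<^sub>F x in residual\<close> is the category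
  quantifier "for generic x". The filter may be trivial in a space that is not Baire;
  \<open>residual_Baire\<close> rules this out for complete spaces.\<close>

definition residual :: "'a::topological_space filter"
  where "residual = Abs_filter (\<lambda>P. comeager {x. P x})"

lemma dense_openI:
  assumes "open S" "\<And>T. open T \<Longrightarrow> T \<noteq> {} \<Longrightarrow> S \<inter> T \<noteq> {}"
  shows "dense_open S"
  using assms by (simp add: dense_open_def)

lemma dense_openD:
  assumes "dense_open S"
  shows "open S" "open T \<Longrightarrow> T \<noteq> {} \<Longrightarrow> S \<inter> T \<noteq> {}"
  using assms by (simp_all add: dense_open_def)

lemma comeager_mono:
  assumes "comeager A" "A \<subseteq> B"
  shows "comeager B"
proof -
  obtain F where F: "countable F" "\<forall>S\<in>F. dense_open S" "\<forall>x. (\<forall>S\<in>F. x \<in> S) \<longrightarrow> x \<in> A"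
    using assms(1) unfolding comeager_def by (elim exE conjE)
  have "\<forall>x. (\<forall>S\<in>F. x \<in> S) \<longrightarrow> x \<in> B"
    using F(3) assms(2) by auto
  with F show ?thesis
    unfolding comeager_def by (intro exI[of _ F] conjI)
qed

lemma comeager_INT:
  assumes "countable I" "\<And>i. i \<in> I \<Longrightarrow> comeager (A i)"
  shows "comeager (\<Inter>i\<in>I. A i)"
proof -
  obtain F where 1: "\<And>i. i \<in> I \<Longrightarrow> countable (F i)" and 2: "\<And>i S. i \<in> I \<Longrightarrow> S \<in> F i \<Longrightarrow> dense_open S"
    and 3: "\<And>i x. i \<in> I \<Longrightarrow> \<forall>S\<in>F i. x \<in> S \<Longrightarrow> x \<in> A i"
    using assms(2) unfolding comeager_def by metis
  have "countable (\<Union>i\<in>I. F i)"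
    by (rule countable_UN[OF assms(1) 1])
  moreover have "\<forall>S\<in>(\<Union>i\<in>I. F i). dense_open S"
    using 2 by blast
  moreover have "\<forall>x. (\<forall>S\<in>(\<Union>i\<in>I. F i). x \<in> S) \<longrightarrow> x \<in> (\<Inter>i\<in>I. A i)"
    using 3 by simp
  ultimately show ?thesis
    unfolding comeager_def by (intro exI[of _ "\<Union>i\<in>I. F i"] conjI)
qed

lemma eventually_residual: "eventually P residual \<longleftrightarrow> comeager {x. P x}"
  unfolding residual_def
proof (rule eventually_Abs_filter, unfold_locales)
  show "comeager {x::'a. True}"
    unfolding comeager_def by (intro exI[of _ "{}"]) auto
next
  fix P Q :: "'a \<Rightarrow> bool"
  assume "comeager {x. P x}" "comeager {x. Q x}"
  \<comment> \<open>The binary intersection is treated as a countable one indexed by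
    \<open>bool\<close>.\<close>
  then have "comeager {x. if b then P x else Q x}" for b
    by (cases b) auto
  then have "comeager (\<Inter>b\<in>UNIV. {x. if b then P x else Q x})"
    by (intro comeager_INT) auto
  moreover have "(\<Inter>b\<in>UNIV. {x. if b then P x else Q x}) = {x. P x \<and> Q x}"
    by (auto split: if_splits)
  ultimately show "comeager {x. P x \<and> Q x}"
    by simp
next
  fix P Q :: "'a \<Rightarrow> bool"
  assume "\<forall>x. P x \<longrightarrow> Q x" "comeager {x. P x}"
  then show "comeager {x. Q x}"
    by (elim comeager_mono) auto
qed

lemma eventually_residual_ball_countable:
  assumes "countable I" "\<And>i. i \<in> I \<Longrightarrow> eventually (P i) residual"
  shows "\<forall>\<^sub>F x in residual. \<forall>i\<in>I. P i x"
proof -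
  have "comeager (\<Inter>i\<in>I. {x. P i x})"
    using assms by (intro comeager_INT) (auto simp: eventually_residual)
  moreover have "(\<Inter>i\<in>I. {x. P i x}) = {x. \<forall>i\<in>I. P i x}"
    by auto
  ultimately show ?thesis
    by (simp add: eventually_residual)
qed

lemma eventually_residual_dense_open:
  assumes "dense_open S" "\<And>x. x \<in> S \<Longrightarrow> P x"
  shows "eventually P residual"
  unfolding eventually_residual comeager_def using assms by (intro exI[of _ "{S}"]) auto

lemma eventually_residualE:
  assumes "eventually P residual"
  obtains I where "countable I" "\<forall>S\<in>I. dense_open S" "\<forall>x. (\<forall>S\<in>I. x \<in> S) \<longrightarrow> P x"
  using assms unfolding eventually_residual comeager_def by auto

text \<open>Preimages of dense open sets stay dense: a nonempty open \<open>T\<close> has an open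
  image, which meets \<open>S\<close>, and any point of \<open>T\<close> lying over the intersection
  is in the preimage.\<close>

lemma eventually_residual_vimage:
  fixes \<phi> :: "'a::topological_space \<Rightarrow> 'b::topological_space"
  assumes "eventually P residual" "continuous_on UNIV \<phi>" "\<And>S. open S \<Longrightarrow> open (\<phi> ` S)"
  shows "\<forall>\<^sub>F x in residual. P (\<phi> x)"
proof -
  obtain I where I: "countable I" "\<forall>S\<in>I. dense_open S" "\<forall>x. (\<forall>S\<in>I. x \<in> S) \<longrightarrow> P x"
    using assms(1) by (rule eventually_residualE)
  have "\<forall>\<^sub>F x in residual. \<phi> x \<in> S" if "S \<in> I" for S
  proof (rule eventually_residual_dense_open[of "\<phi> -` S"], rule dense_openI)
    have S: "dense_open S"
      using I(2) that by blast
    then show "open (\<phi> -` S)"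
      using assms(2) by (simp add: open_vimage dense_open_def)
    fix T :: "'a set" assume T: "open T" "T \<noteq> {}"
    then have "S \<inter> \<phi> ` T \<noteq> {}"
      using S assms(3)[OF T(1)] unfolding dense_open_def by blast
    then show "\<phi> -` S \<inter> T \<noteq> {}"
      by blast
  qed auto
  then have "\<forall>\<^sub>F x in residual. \<forall>S\<in>I. \<phi> x \<in> S"
    using I(1) by (intro eventually_residual_ball_countable)
  then show ?thesis
    by eventually_elim (use I(3) in blast)
qed

lemma eventually_residual_homeomorphism:
  fixes \<phi> :: "'a::topological_space \<Rightarrow> 'b::topological_space"
  assumes "eventually P residual" "continuous_on UNIV \<phi>" "continuous_on UNIV \<psi>"
    "\<And>x. \<psi> (\<phi> x) = x" "\<And>y. \<phi> (\<psi> y) = y"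
  shows "\<forall>\<^sub>F x in residual. P (\<phi> x)"
proof (rule eventually_residual_vimage[OF assms(1,2)])
  fix S :: "'a set" assume "open S"
  then have "open (\<psi> -` S)"
    using assms(3) by (simp add: open_vimage)
  moreover have "\<phi> ` S = \<psi> -` S"
  proof (intro equalityI subsetI)
    fix y assume "y \<in> \<psi> -` S"
    then have "\<phi> (\<psi> y) \<in> \<phi> ` S"
      by blast
    then show "y \<in> \<phi> ` S"
      by (simp only: assms(5))
  qed (auto simp: assms(4))
  ultimately show "open (\<phi> ` S)"
    by simp
qed

text \<open>The Baire category theorem in the form by which points are chosen throughout.\<close>

lemma residual_Baire:
  fixes V :: "'a::complete_space set"
  assumes "eventually P residual" "open V" "v \<in> V"
  obtains x where "x \<in> V" "P x"
proof -
  obtain F where F: "countable F" "\<forall>S\<in>F. dense_open S" "\<forall>x. (\<forall>S\<in>F. x \<in> S) \<longrightarrow> P x"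
    using assms(1) by (rule eventually_residualE)
  have "closure S = UNIV" if "dense_open S" for S :: "'a set"
  proof -
    have "S \<inter> - closure S = {}"
      using closure_subset by blast
    then have "- closure S = {}"
      using that unfolding dense_open_def by (metis open_Compl closed_closure)
    then show ?thesis
      by blast
  qed
  with F(2) have "openin euclidean S \<and> euclidean closure_of S = topspace euclidean" if "S \<in> F" for S
    using that by (simp add: euclidean_closure_of dense_open_def)
  from Baire_category[OF disjI1[OF completely_metrizable_space_euclidean] F(1) this]
  have "closure (\<Inter>F) = UNIV"
    by (simp add: euclidean_closure_of)
  then have "\<Inter>F \<inter> V \<noteq> {}"
    using assms(2,3) open_Int_closure_eq_empty[of V "\<Inter>F"] by (auto simp: Int_commute)
  then show thesis
    using F(3) that by blast
qed

text \<open>The sets that agree with an open set off a meager set form a sigma-algebra containing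
  the open sets.\<close>

lemma borel_Baire_property:
  assumes "A \<in> sets borel"
  obtains S where "open S" "\<forall>\<^sub>F x in residual. x \<in> A \<longleftrightarrow> x \<in> S"
proof -
  have "A \<in> sigma_sets UNIV {S::'a set. open S}"
    using assms by (simp only: sets_borel)
  then have "\<exists>S. open S \<and> (\<forall>\<^sub>F x in residual. x \<in> A \<longleftrightarrow> x \<in> S)"
  proof induction
    case (Basic A)
    then show ?case by auto
  next
    case Empty
    show ?case by (intro exI[of _ "{}"]) auto
  next
    case (Compl A)
    then obtain S where S: "open S" "\<forall>\<^sub>F x in residual. x \<in> A \<longleftrightarrow> x \<in> S"
      by blast
    \<comment> \<open>The boundary of an open set is nowhere dense, so generically the complement of
      \<open>S\<close> may be replaced by the open set \<open>- closure S\<close>.\<close>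
    have "\<forall>\<^sub>F x in residual. x \<notin> S \<longrightarrow> x \<notin> closure S"
    proof (rule eventually_residual_dense_open[of "S \<union> - closure S"], rule dense_openI)
      show "open (S \<union> - closure S)"
        using S by auto
      show "(S \<union> - closure S) \<inter> T \<noteq> {}" if "open T" "T \<noteq> {}" for T
        using that open_Int_closure_eq_empty[of T S] by blast
    qed auto
    with S(2) have "\<forall>\<^sub>F x in residual. x \<in> UNIV - A \<longleftrightarrow> x \<in> - closure S"
      by eventually_elim (use closure_subset in auto)
    then show ?case
      by (intro exI[of _ "- closure S"]) auto
  next
    case (Union A)
    then obtain S where S: "\<And>i. open (S i)" "\<And>i. \<forall>\<^sub>F x in residual. x \<in> A i \<longleftrightarrow> x \<in> S i"
      by metis
    have "\<forall>\<^sub>F x in residual. \<forall>i\<in>UNIV. x \<in> A i \<longleftrightarrow> x \<in> S i"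
      using S(2) by (intro eventually_residual_ball_countable) auto
    then have "\<forall>\<^sub>F x in residual. x \<in> \<Union>(range A) \<longleftrightarrow> x \<in> \<Union>(range S)"
      by eventually_elim auto
    then show ?case
      using S(1) by (intro exI[of _ "\<Union>(range S)"]) auto
  qed
  then show thesis
    using that by blast
qed

text \<open>The preimage of each member of a countable base agrees with an open set off a meager
  set. Removing these countably many meager sets makes all the preimages relatively open.\<close>

lemma borel_measurable_continuous_on_residual:
  fixes f :: "'a::topological_space \<Rightarrow> 'b::second_countable_topology"
  assumes "f \<in> borel \<rightarrow>\<^sub>M borel"
  obtains C where "\<forall>\<^sub>F x in residual. x \<in> C"
    "\<forall>x\<in>C. \<forall>U. open U \<longrightarrow> f x \<in> U \<longrightarrow> (\<exists>T. open T \<and> x \<in> T \<and> (\<forall>y\<in>T \<inter> C. f y \<in> U))"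
proof -
  obtain B :: "'b set set" where B: "countable B" "topological_basis B"
    using ex_countable_basis by blast
  have "f -` b \<in> sets borel" if "b \<in> B" for b
  proof -
    have "b \<in> sets borel"
      using topological_basis_open[OF B(2) that] by simp
    then show ?thesis
      using measurable_sets[OF assms, of b] by simp
  qed
  then have "\<exists>S. open S \<and> (\<forall>\<^sub>F x in residual. x \<in> f -` b \<longleftrightarrow> x \<in> S)" if "b \<in> B" for b
    using borel_Baire_property that by metis
  then obtain S where S: "\<And>b. b \<in> B \<Longrightarrow> open (S b)"
    "\<And>b. b \<in> B \<Longrightarrow> \<forall>\<^sub>F x in residual. x \<in> f -` b \<longleftrightarrow> x \<in> S b"
    by metis
  define C where "C = {x. \<forall>b\<in>B. x \<in> f -` b \<longleftrightarrow> x \<in> S b}"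
  have "\<forall>\<^sub>F x in residual. x \<in> C"
    unfolding C_def mem_Collect_eq using S B by (intro eventually_residual_ball_countable) auto
  moreover have "\<exists>T. open T \<and> x \<in> T \<and> (\<forall>y\<in>T \<inter> C. f y \<in> U)" if "x \<in> C" "open U" "f x \<in> U" for x U
  proof -
    obtain b where "b \<in> B" "f x \<in> b" "b \<subseteq> U"
      using B(2) \<open>open U\<close> \<open>f x \<in> U\<close> by (meson topological_basisE)
    then show ?thesis
      using that(1) S(1) unfolding C_def by (intro exI[of _ "S b"]) auto
  qed
  ultimately show thesis
    by (intro that[of C]) simp_all
qed

text \<open>For dense open \<open>S\<close> and nonempty basic open \<open>b\<close>, the points
  \<open>y\<close> whose section of \<open>S\<close> meets \<open>b\<close> form a projection that
  is again dense open. A generic \<open>y\<close> works for all \<open>b\<close> of a countable base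
  at once, so its section of \<open>S\<close> is dense open.\<close>

lemma Kuratowski_Ulam:
  fixes P :: "'a::second_countable_topology \<times> 'b::topological_space \<Rightarrow> bool"
  assumes "eventually P residual"
  shows "\<forall>\<^sub>F y in residual. \<forall>\<^sub>F x in residual. P (x, y)"
proof -
  obtain I where I: "countable I" "\<forall>S\<in>I. dense_open S" "\<forall>x. (\<forall>S\<in>I. x \<in> S) \<longrightarrow> P x"
    using assms by (rule eventually_residualE)
  obtain B :: "'a set set" where B: "countable B" "topological_basis B"
    using ex_countable_basis by blast
  have slice: "\<forall>\<^sub>F y in residual. \<forall>\<^sub>F x in residual. (x, y) \<in> S" if "S \<in> I" for S
  proof -
    have S: "dense_open S"
      using I(2) that by blast
    have "\<forall>\<^sub>F y in residual. b \<noteq> {} \<longrightarrow> (\<exists>x\<in>b. (x, y) \<in> S)" if "b \<in> B" for b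
    proof (cases "b = {}")
      case False
      have "open b"
        using that B topological_basis_open by blast
      then have op: "open (b \<times> T)" if "open T" for T :: "'b set"
        using that by (rule open_Times)
      show ?thesis
      proof (rule eventually_residual_dense_open[of "snd ` (S \<inter> b \<times> UNIV)"], rule dense_openI)
        show "open (snd ` (S \<inter> b \<times> UNIV))"
          using S by (intro open_image_snd open_Int op) (auto simp: dense_open_def)
        fix T :: "'b set" assume "open T" "T \<noteq> {}"
        then have "S \<inter> b \<times> T \<noteq> {}"
          using False by (intro dense_openD(2)[OF S] op) auto
        then show "snd ` (S \<inter> b \<times> UNIV) \<inter> T \<noteq> {}"
          by force
      qed force
    qed simp
    then have "\<forall>\<^sub>F y in residual. \<forall>b\<in>B. b \<noteq> {} \<longrightarrow> (\<exists>x\<in>b. (x, y) \<in> S)"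
      using B(1) by (intro eventually_residual_ball_countable)
    then show ?thesis
    proof eventually_elim
      case (elim y)
      have "open ((\<lambda>x. (x, y)) -` S)"
        using S by (intro open_vimage continuous_intros) (simp add: dense_open_def)
      moreover have "(\<lambda>x. (x, y)) -` S \<inter> T \<noteq> {}" if T: "open T" "T \<noteq> {}" for T
      proof -
        obtain t where "t \<in> T"
          using T(2) by blast
        then obtain b where "b \<in> B" "t \<in> b" "b \<subseteq> T"
          using B(2) T(1) by (meson topological_basisE)
        then show ?thesis
          using elim by blast
      qed
      ultimately have "dense_open ((\<lambda>x. (x, y)) -` S)"
        by (rule dense_openI)
      then show ?case
        by (rule eventually_residual_dense_open) simp
    qed
  qed
  have "\<forall>\<^sub>F y in residual. \<forall>S\<in>I. \<forall>\<^sub>F x in residual. (x, y) \<in> S"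
    using I(1) slice by (rule eventually_residual_ball_countable)
  then show ?thesis
  proof eventually_elim
    case (elim y)
    then have "\<forall>\<^sub>F x in residual. \<forall>S\<in>I. (x, y) \<in> S"
      using I(1) by (intro eventually_residual_ball_countable) auto
    then show ?case
      by eventually_elim (use I(3) in blast)
  qed
qed

lemma Kuratowski_Ulam':
  fixes P :: "'a::topological_space \<times> 'b::second_countable_topology \<Rightarrow> bool"
  assumes "eventually P residual"
  shows "\<forall>\<^sub>F x in residual. \<forall>\<^sub>F y in residual. P (x, y)"
proof -
  have "\<forall>\<^sub>F p in residual. P (snd p, fst p)"
    by (rule eventually_residual_homeomorphism[OF assms, where \<psi> = "\<lambda>p. (snd p, fst p)"])
      (auto intro!: continuous_intros)
  from Kuratowski_Ulam[OF this] show ?thesis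
    by simp
qed

subsection \<open>Continuous actions\<close>

locale continuous_action =
  fixes act :: "'k::topological_group_add \<Rightarrow> 'x::topological_space \<Rightarrow> 'x"
  assumes act_zero: "act 0 x = x"
    and act_add: "act (g + h) x = act g (act h x)"
    and continuous_act: "continuous_on UNIV (\<lambda>p. act (fst p) (snd p))"
begin

lemma act_minus [simp]: "act (- g) (act g x) = x" "act g (act (- g) x) = x"
  by (simp_all add: act_add[symmetric] act_zero)

lemma act_diff [simp]: "act (g - h) (act h x) = act g x"
  by (simp add: act_add[symmetric])

lemma continuous_on_act:
  assumes "continuous_on A u" "continuous_on A v"
  shows "continuous_on A (\<lambda>p. act (u p) (v p))"
  using continuous_on_compose2[OF continuous_act continuous_on_Pair[OF assms]] by simp

lemma open_act_vimage:
  assumes "open U"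
  shows "open {x. act g x \<in> U}" "open {g. act g x \<in> U}" "open {p. act (fst p) (snd p) \<in> U}"
  using open_vimage[OF assms, of "act g"] open_vimage[OF assms, of "\<lambda>g. act g x"]
    open_vimage[OF assms continuous_act]
  by (simp_all add: vimage_def continuous_on_act continuous_on_id continuous_on_const)

lemma residual_act:
  assumes "eventually P residual"
  shows "\<forall>\<^sub>F x in residual. P (act g x)"
  by (rule eventually_residual_homeomorphism[OF assms, where \<psi> = "act (- g)"])
    (auto intro!: continuous_on_act continuous_intros)

text \<open>The action map is open: the image of an open set is the union over \<open>g\<close> of
  the \<open>g\<close>-translates of its sections. Hence a generic pair \<open>(g, x)\<close> has a
  generic value \<open>gx\<close>.\<close>

lemma residual_act_pair:
  assumes "eventually P residual"
  shows "\<forall>\<^sub>F p in residual. P (act (fst p) (snd p))"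
proof (rule eventually_residual_vimage[OF assms continuous_act])
  fix S :: "('k \<times> 'x) set" assume "open S"
  have "open ((\<lambda>x. (g, act (- g) x)) -` S)" for g
    by (intro open_vimage \<open>open S\<close> continuous_on_act continuous_intros)
  then have "open (\<Union>g. {x. (g, act (- g) x) \<in> S})"
    by (auto simp: vimage_def)
  moreover have "(\<lambda>p. act (fst p) (snd p)) ` S = (\<Union>g. {x. (g, act (- g) x) \<in> S})"
  proof (intro equalityI subsetI)
    fix x assume "x \<in> (\<Union>g. {x. (g, act (- g) x) \<in> S})"
    then obtain g where "(g, act (- g) x) \<in> S"
      by blast
    then show "x \<in> (\<lambda>p. act (fst p) (snd p)) ` S"
      by (intro image_eqI[of _ _ "(g, act (- g) x)"]) auto
  next
    fix x assume "x \<in> (\<lambda>p. act (fst p) (snd p)) ` S"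
    then obtain g z where "(g, z) \<in> S" "x = act g z"
      by auto
    then have "x \<in> {x. (g, act (- g) x) \<in> S}"
      by simp
    then show "x \<in> (\<Union>g. {x. (g, act (- g) x) \<in> S})"
      by blast
  qed
  ultimately show "open ((\<lambda>p. act (fst p) (snd p)) ` S)"
    by simp
qed

end

lemma residual_add_right:
  fixes a :: "'k::topological_group_add"
  assumes "eventually P residual"
  shows "\<forall>\<^sub>F g in residual. P (g + a)"
  by (rule eventually_residual_homeomorphism[OF assms, where \<psi> = "\<lambda>g. g - a"])
    (auto intro!: continuous_intros)

section \<open>The relation \<open>usq\<close> under equivariant maps and under moving its two
  points\<close>

lemma usq_zero:
  "usq K e act 0 V x y \<longleftrightarrow> y \<in> closure ((\<lambda>g. act g x) ` V) \<and> x \<in> closure ((\<lambda>g. act g y) ` V)"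
  by (subst usq.simps) simp

lemma usq_pos:
  assumes "\<alpha> \<noteq> 0"
  shows "usq K e act \<alpha> V x y \<longleftrightarrow>
    (\<forall>W U. openin K W \<and> e \<in> W \<and> open U \<and> (x \<in> U \<or> y \<in> U) \<longrightarrow>
       (\<exists>gx\<in>V. \<exists>gy\<in>V. act gx x \<in> U \<and> act gy y \<in> U \<and>
         (\<forall>\<beta>. \<beta> < \<alpha> \<longrightarrow> usq K e act \<beta> W (act gx x) (act gy y))))"
  using assms by (subst usq.simps) simp

text \<open>Open sets \<open>U\<close> are pulled back along \<open>\<phi>\<close> and the same
  group elements are reused. Applied to right translations, this moves a witness of unbalancedness
  into generic position.\<close>

lemma usq_commuting_map:
  fixes \<phi> :: "'x::topological_space \<Rightarrow> 'x"
  assumes "usq K e act \<alpha> V x y"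
    and \<phi>: "continuous_on UNIV \<phi>" "\<And>g x. g \<in> topspace K \<Longrightarrow> \<phi> (act g x) = act g (\<phi> x)"
    and "V \<subseteq> topspace K"
  shows "usq K e act \<alpha> V (\<phi> x) (\<phi> y)"
  using assms(1,4)
proof (induction \<alpha> arbitrary: V x y rule: less_induct)
  case (less \<alpha>)
  have eq: "act g (\<phi> x) = \<phi> (act g x)" if "g \<in> V" for g x
    using \<phi>(2) that less.prems(2) by auto
  show ?case
  proof (cases "\<alpha> = 0")
    case True
    have "\<phi> y \<in> closure ((\<lambda>g. act g (\<phi> x)) ` V)" if "y \<in> closure ((\<lambda>g. act g x) ` V)" for x y
    proof -
      have "\<phi> ` closure ((\<lambda>g. act g x) ` V) \<subseteq> closure ((\<lambda>g. act g (\<phi> x)) ` V)"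
        by (rule image_closure_subset)
          (auto simp: eq intro!: continuous_on_subset[OF \<phi>(1)] closure_subset[THEN subsetD])
      then show ?thesis
        using that by blast
    qed
    then show ?thesis
      using less.prems(1) True by (simp add: usq_zero)
  next
    case False
    show ?thesis
      unfolding usq_pos[OF False]
    proof (intro allI impI)
      fix W and U :: "'x set"
      assume *: "openin K W \<and> e \<in> W \<and> open U \<and> (\<phi> x \<in> U \<or> \<phi> y \<in> U)"
      then have "open (\<phi> -` U)" "x \<in> \<phi> -` U \<or> y \<in> \<phi> -` U"
        using \<phi>(1) by (auto intro: open_vimage)
      then obtain gx gy where g: "gx \<in> V" "gy \<in> V" "act gx x \<in> \<phi> -` U" "act gy y \<in> \<phi> -` U"
        "\<forall>\<beta><\<alpha>. usq K e act \<beta> W (act gx x) (act gy y)"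
        using less.prems(1) * unfolding usq_pos[OF False] by metis
      have "\<forall>\<beta><\<alpha>. usq K e act \<beta> W (\<phi> (act gx x)) (\<phi> (act gy y))"
        using less.IH g(5) * openin_subset by metis
      then show "\<exists>gx\<in>V. \<exists>gy\<in>V. act gx (\<phi> x) \<in> U \<and> act gy (\<phi> y) \<in> U \<and>
          (\<forall>\<beta><\<alpha>. usq K e act \<beta> W (act gx (\<phi> x)) (act gy (\<phi> y)))"
        using g by (intro bexI[of _ gx] bexI[of _ gy]) (simp_all add: eq)
    qed
  qed
qed

context continuous_action
begin

text \<open>If \<open>v\<close> carries \<open>x\<close> to \<open>act v x\<close>, then
  \<open>b + v - a\<close> carries \<open>act a x\<close> to \<open>act b (act v x)\<close>, which
  explains the condition on \<open>V'\<close>. The purpose is to replace the group elements provided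
  by the relation by nearby generic ones.\<close>

lemma usq_perturb:
  assumes "usq euclidean 0 act \<alpha> V x y"
    and "\<And>a b v. a \<in> {k, l} \<Longrightarrow> b \<in> {k, l} \<Longrightarrow> v \<in> V \<Longrightarrow> a + v - b \<in> V'"
  shows "usq euclidean 0 act \<alpha> V' (act k x) (act l y)"
  using assms
proof (induction \<alpha> arbitrary: V V' x y k l rule: less_induct)
  case (less \<alpha>)
  show ?case
  proof (cases "\<alpha> = 0")
    case True
    have "act b y \<in> closure ((\<lambda>g. act g (act a x)) ` V')"
      if "y \<in> closure ((\<lambda>g. act g x) ` V)" "a \<in> {k, l}" "b \<in> {k, l}" for x y a b
    proof -
      have "act b ` closure ((\<lambda>g. act g x) ` V) \<subseteq> closure ((\<lambda>g. act g (act a x)) ` V')"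
      proof (rule image_closure_subset)
        show "continuous_on (closure ((\<lambda>g. act g x) ` V)) (act b)"
          by (intro continuous_on_act continuous_intros)
        show "act b ` (\<lambda>g. act g x) ` V \<subseteq> closure ((\<lambda>g. act g (act a x)) ` V')"
        proof (intro subset_trans[OF _ closure_subset] subsetI)
          fix z assume "z \<in> act b ` (\<lambda>g. act g x) ` V"
          then obtain v where "v \<in> V" "z = act b (act v x)"
            by blast
          then show "z \<in> (\<lambda>g. act g (act a x)) ` V'"
            using less.prems(2) that by (intro image_eqI[of _ _ "b + v - a"]) (auto simp: act_add)
        qed
      qed simp
      then show ?thesis
        using that by blast
    qed
    then show ?thesis
      using less.prems(1) True by (simp add: usq_zero)
  next
    case False
    show ?thesis
      unfolding usq_pos[OF False]
    proof (intro allI impI)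
      fix W :: "'k set" and U :: "'x set"
      assume *: "openin euclidean W \<and> 0 \<in> W \<and> open U \<and> (act k x \<in> U \<or> act l y \<in> U)"
      \<comment> \<open>Here \<open>a\<close> is \<open>k\<close> or \<open>l\<close> according to
        which of the two points lies in \<open>U\<close>. Both new points are then moved by this
        same \<open>a\<close>, so the inductive call has \<open>k = l = a\<close>, and
        \<open>W\<close> is traded for a conjugate.\<close>
      then obtain a where a: "a \<in> {k, l}" "x \<in> {z. act a z \<in> U} \<or> y \<in> {z. act a z \<in> U}"
        by auto
      have "open ((\<lambda>w. a + w - a) -` W)"
        using * by (intro open_vimage continuous_intros) auto
      then have "openin euclidean {w. a + w - a \<in> W} \<and> 0 \<in> {w. a + w - a \<in> W} \<and>
          open {z. act a z \<in> U} \<and> (x \<in> {z. act a z \<in> U} \<or> y \<in> {z. act a z \<in> U})"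
        using * a(2) open_act_vimage(1) by (auto simp: vimage_def)
      then obtain gx gy where g: "gx \<in> V" "gy \<in> V" "act a (act gx x) \<in> U" "act a (act gy y) \<in> U"
        "\<forall>\<beta><\<alpha>. usq euclidean 0 act \<beta> {w. a + w - a \<in> W} (act gx x) (act gy y)"
        using less.prems(1) unfolding usq_pos[OF False] by (metis mem_Collect_eq)
      have "\<forall>\<beta><\<alpha>. usq euclidean 0 act \<beta> W (act a (act gx x)) (act a (act gy y))"
      proof (intro allI impI)
        fix \<beta> assume "\<beta> < \<alpha>"
        then show "usq euclidean 0 act \<beta> W (act a (act gx x)) (act a (act gy y))"
          by (rule less.IH[where V = "{w. a + w - a \<in> W}"]) (use g(5) \<open>\<beta> < \<alpha>\<close> in auto)
      qed
      then show "\<exists>gx\<in>V'. \<exists>gy\<in>V'. act gx (act k x) \<in> U \<and> act gy (act l y) \<in> U \<and>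
          (\<forall>\<beta><\<alpha>. usq euclidean 0 act \<beta> W (act gx (act k x)) (act gy (act l y)))"
        using g a(1) by (intro bexI[of _ "a + gx - k"] bexI[of _ "a + gy - l"])
          (auto simp: act_add less.prems(2))
    qed
  qed
qed

end

subsection \<open>Orbit continuity\<close>

text \<open>
  The countably many translates \<open>W\<^sub>1h\<close> cover the group, so \<open>f(gx) \<in> W\<^sub>1h f(x)\<close> for one fixed \<open>h\<close>
  and generic \<open>(g, x)\<close> in some box \<open>V\<^sub>0 \<times> U\<^sub>0\<close>; two such relations for \<open>g\<close> and \<open>k\<close> combine to
  \<open>f(gx) \<in> W\<^sub>1W\<^sub>1\<inverse> f(kx)\<close>, and \<open>kx\<close> is generic in \<open>kU\<^sub>0\<close>.
\<close>

lemma orbit_continuity_local: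
  fixes a :: "'k::{topological_group_add, polish_space} \<Rightarrow> 'x::polish_space \<Rightarrow> 'x"
    and b :: "'l::{topological_group_add, second_countable_topology} \<Rightarrow> 'y::second_countable_topology \<Rightarrow> 'y"
  assumes "continuous_action a" "continuous_action b"
    and f: "f \<in> borel \<rightarrow>\<^sub>M borel"
    and hom: "\<And>g x. \<exists>h. f (a g x) = b h (f x)"
    and W1: "open W1" "0 \<in> W1" "{p. \<exists>w\<in>W1. fst p = b w (snd p)} \<in> sets borel"
    and W: "\<And>v w. v \<in> W1 \<Longrightarrow> w \<in> W1 \<Longrightarrow> v - w \<in> W"
    and U1: "open U1" "U1 \<noteq> {}"
  obtains U V where "open U" "U \<noteq> {}" "U \<subseteq> U1" "open V" "0 \<in> V"
    "\<forall>\<^sub>F x in residual. x \<in> U \<longrightarrow> (\<forall>\<^sub>F g in residual. g \<in> V \<longrightarrow> (\<exists>w\<in>W. f (a g x) = b w (f x)))"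
proof -
  interpret A: continuous_action a by fact
  interpret B: continuous_action b by fact
  obtain D :: "'l set" where D: "countable D" "\<forall>X. open X \<longrightarrow> X \<noteq> {} \<longrightarrow> (\<exists>d\<in>D. d \<in> X)"
    using countable_dense_exists by blast
  \<comment> \<open>The orbit relation of \<open>W1\<close> is assumed Borel so that each
    \<open>R h\<close>, the set of \<open>(g, x)\<close> with \<open>f(gx)\<close> in
    \<open>W1 h f(x)\<close>, is Borel and hence generically equal to an open set.\<close>
  define R where "R h = {p. \<exists>w\<in>W1. f (a (fst p) (snd p)) = b w (b h (f (snd p)))}" for h
  have "\<exists>S. open S \<and> (\<forall>\<^sub>F p in residual. p \<in> R h \<longleftrightarrow> p \<in> S)" for h
  proof -
    have "(\<lambda>p. (f (a (fst p) (snd p)), b h (f (snd p)))) \<in> borel \<rightarrow>\<^sub>M borel"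
    proof (rule borel_measurable_Pair)
      show "(\<lambda>p. f (a (fst p) (snd p))) \<in> borel \<rightarrow>\<^sub>M borel"
        by (rule measurable_compose[OF borel_measurable_continuous_onI[OF A.continuous_act] f])
      have "b h \<in> borel \<rightarrow>\<^sub>M borel"
        by (intro borel_measurable_continuous_onI B.continuous_on_act continuous_intros)
      moreover have "(\<lambda>p::'k \<times> 'x. f (snd p)) \<in> borel \<rightarrow>\<^sub>M borel"
        by (rule measurable_compose[OF borel_measurable_continuous_onI f]) (intro continuous_intros)
      ultimately show "(\<lambda>p::'k \<times> 'x. b h (f (snd p))) \<in> borel \<rightarrow>\<^sub>M borel"
        by (rule measurable_compose[rotated])
    qed
    from measurable_sets[OF this W1(3)] have "R h \<in> sets borel"
      by (simp add: R_def vimage_def)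
    then show ?thesis
      by (rule borel_Baire_property) blast
  qed
  then obtain S where S: "\<And>h. open (S h)" "\<And>h. \<forall>\<^sub>F p in residual. p \<in> R h \<longleftrightarrow> p \<in> S h"
    by metis
  have gen: "\<forall>\<^sub>F p in residual. \<forall>h\<in>D. p \<in> R h \<longleftrightarrow> p \<in> S h"
    using D(1) S(2) by (intro eventually_residual_ball_countable)
  \<comment> \<open>Working inside \<open>N\<close> keeps \<open>gx\<close> in \<open>U1\<close>; at
    the end this forces the translate of \<open>U0\<close> by \<open>k\<close> into
    \<open>U1\<close>.\<close>
  define N where "N = {p. a (fst p) (snd p) \<in> U1}"
  have N: "open N"
    unfolding N_def by (rule A.open_act_vimage[OF U1(1)])
  obtain u where "u \<in> U1"
    using U1(2) by blast
  then have "(0, u) \<in> N"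
    by (simp add: N_def A.act_zero)
  with gen N obtain p where p: "p \<in> N" "\<forall>h\<in>D. p \<in> R h \<longleftrightarrow> p \<in> S h"
    by (rule residual_Baire)
  obtain l where l: "f (a (fst p) (snd p)) = b l (f (snd p))"
    using hom by blast
  \<comment> \<open>Some \<open>h\<close> in the dense set \<open>D\<close> is close enough to
    \<open>l\<close> that \<open>l\<close> lies in \<open>W1 h\<close>. The generic point
    \<open>p\<close> is then in \<open>R h\<close>, hence in the open set \<open>S h\<close>, which
    therefore contains a box around \<open>p\<close>.\<close>
  have "open ((\<lambda>h. l - h) -` W1)"
    by (intro open_vimage W1 continuous_intros)
  moreover have "l \<in> (\<lambda>h. l - h) -` W1"
    using W1(2) by simp
  ultimately obtain h where h: "h \<in> D" "l - h \<in> W1"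
    using D(2) by (metis empty_iff vimage_eq)
  then have "p \<in> R h"
    unfolding R_def using l by (auto intro!: bexI[of _ "l - h"])
  then have "p \<in> S h \<inter> N"
    using p h(1) by blast
  moreover have "open (S h \<inter> N)"
    using S(1) N by (rule open_Int)
  ultimately obtain V0 U0 where VU: "open V0" "open U0" "p \<in> V0 \<times> U0" "V0 \<times> U0 \<subseteq> S h \<inter> N"
    by (metis open_prod_elim)
  have box: "\<forall>\<^sub>F p in residual. fst p \<in> V0 \<longrightarrow> snd p \<in> U0 \<longrightarrow> p \<in> R h"
    using S(2)[of h] by eventually_elim (use VU(4) in \<open>auto simp: mem_Times_iff\<close>)
  have "\<forall>\<^sub>F g in residual. \<forall>\<^sub>F x in residual. g \<in> V0 \<longrightarrow> x \<in> U0 \<longrightarrow> (g, x) \<in> R h"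
    using Kuratowski_Ulam'[OF box] by simp
  moreover have "fst p \<in> V0"
    using VU(3) by (simp add: mem_Times_iff)
  \<comment> \<open>Kuratowski-Ulam yields one fixed \<open>k\<close> good for generic
    \<open>x\<close>; the value \<open>f(kx)\<close> is the reference point for all other
    \<open>g\<close> in \<open>V0\<close>.\<close>
  ultimately obtain k where k: "k \<in> V0" "\<forall>\<^sub>F x in residual. k \<in> V0 \<longrightarrow> x \<in> U0 \<longrightarrow> (k, x) \<in> R h"
    using VU(1) by (metis (lifting) residual_Baire)
  have "\<forall>\<^sub>F x in residual. x \<in> U0 \<longrightarrow>
      (\<forall>\<^sub>F g in residual. g \<in> V0 \<longrightarrow> (\<exists>w\<in>W. f (a g x) = b w (f (a k x))))"
    using k(2) Kuratowski_Ulam[OF box]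
  proof eventually_elim
    case (elim x)
    show ?case
    proof
      assume "x \<in> U0"
      then obtain w' where w': "w' \<in> W1" "f (a k x) = b w' (b h (f x))"
        using elim(1) k(1) by (auto simp: R_def)
      show "\<forall>\<^sub>F g in residual. g \<in> V0 \<longrightarrow> (\<exists>w\<in>W. f (a g x) = b w (f (a k x)))"
        using elim(2)
      proof eventually_elim
        case (elim g)
        show ?case
        proof
          assume "g \<in> V0"
          then obtain w where "w \<in> W1" "f (a g x) = b w (b h (f x))"
            using elim \<open>x \<in> U0\<close> by (auto simp: R_def)
          then show "\<exists>w\<in>W. f (a g x) = b w (f (a k x))"
            using w' W by (intro bexI[of _ "w - w'"]) auto
        qed
      qed
    qed
  qed
  \<comment> \<open>Replacing \<open>x\<close> by its translate under \<open>- k\<close> turns the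
    reference point \<open>f(kx)\<close> into \<open>f(x)\<close>. Replacing \<open>g\<close> by
    \<open>g + k\<close> afterwards makes the neighbourhood contain 0.\<close>
  from A.residual_act[OF this, of "- k"]
  have shifted: "\<forall>\<^sub>F x in residual. a (- k) x \<in> U0 \<longrightarrow>
      (\<forall>\<^sub>F g in residual. g \<in> V0 \<longrightarrow> (\<exists>w\<in>W. f (a g (a (- k) x)) = b w (f x)))"
    by simp
  show thesis
  proof
    show "open {x. a (- k) x \<in> U0}"
      by (rule A.open_act_vimage[OF VU(2)])
    show "{x. a (- k) x \<in> U0} \<noteq> {}"
    proof -
      have "a k (snd p) \<in> {x. a (- k) x \<in> U0}"
        using VU(3) by (simp add: mem_Times_iff)
      then show ?thesis
        by blast
    qed
    show "{x. a (- k) x \<in> U0} \<subseteq> U1"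
    proof
      fix x assume "x \<in> {x. a (- k) x \<in> U0}"
      then have "(k, a (- k) x) \<in> N"
        using k(1) VU(4) by blast
      then show "x \<in> U1"
        by (simp add: N_def)
    qed
    show "open ((\<lambda>g. g + k) -` V0)"
      by (intro open_vimage VU(1) continuous_intros)
    show "0 \<in> (\<lambda>g. g + k) -` V0"
      using k(1) by simp
    show "\<forall>\<^sub>F x in residual. x \<in> {x. a (- k) x \<in> U0} \<longrightarrow>
        (\<forall>\<^sub>F g in residual. g \<in> (\<lambda>g. g + k) -` V0 \<longrightarrow> (\<exists>w\<in>W. f (a g x) = b w (f x)))"
      using shifted
    proof eventually_elim
      case (elim x)
      show ?case
      proof
        assume "x \<in> {x. a (- k) x \<in> U0}"
        then have "\<forall>\<^sub>F g in residual. g \<in> V0 \<longrightarrow> (\<exists>w\<in>W. f (a g (a (- k) x)) = b w (f x))"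
          using elim by blast
        from residual_add_right[OF this, of k]
        show "\<forall>\<^sub>F g in residual. g \<in> (\<lambda>g. g + k) -` V0 \<longrightarrow> (\<exists>w\<in>W. f (a g x) = b w (f x))"
          by (simp add: A.act_add)
      qed
    qed
  qed
qed

text \<open>Only generic \<open>g\<close> in \<open>V\<close> are constrained, because a Borel
  \<open>f\<close> cannot be controlled at every \<open>g\<close>.\<close>

definition orbit_bounded ::
  "('k::topological_space \<Rightarrow> 'x \<Rightarrow> 'x) \<Rightarrow> ('l \<Rightarrow> 'y \<Rightarrow> 'y) \<Rightarrow> ('x \<Rightarrow> 'y) \<Rightarrow> 'k set \<Rightarrow> 'l set \<Rightarrow> 'x \<Rightarrow> bool"
  where "orbit_bounded a b f V W x \<longleftrightarrow>
    (\<forall>\<^sub>F g in residual. g \<in> V \<longrightarrow> (\<exists>w\<in>W. f (a g x) = b w (f x)))"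

text \<open>The local version gives, for each \<open>W\<close>, a dense open set of points having a
  suitable pair of basic sets \<open>(T, V)\<close>. As the bases are countable, the requirements
  for all basic \<open>W\<close> and all such pairs hold together on a comeager set.\<close>

lemma orbit_continuity:
  fixes a :: "'k::{topological_group_add, polish_space} \<Rightarrow> 'x::polish_space \<Rightarrow> 'x"
    and b :: "'l::{topological_group_add, second_countable_topology} \<Rightarrow> 'y::second_countable_topology \<Rightarrow> 'y"
  assumes "continuous_action a" "continuous_action b"
    and f: "f \<in> borel \<rightarrow>\<^sub>M borel"
    and hom: "\<And>g x. \<exists>h. f (a g x) = b h (f x)"
    and base: "\<And>W. open W \<Longrightarrow> 0 \<in> W \<Longrightarrow> \<exists>W1. open W1 \<and> 0 \<in> W1 \<and>
      {p. \<exists>w\<in>W1. fst p = b w (snd p)} \<in> sets borel \<and> (\<forall>v\<in>W1. \<forall>w\<in>W1. v - w \<in> W)"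
  obtains C where "\<forall>\<^sub>F x in residual. x \<in> C"
    "\<forall>x\<in>C. \<forall>\<^sub>F g in residual. a g x \<in> C"
    "\<forall>x\<in>C. \<forall>U. open U \<longrightarrow> f x \<in> U \<longrightarrow> (\<exists>T. open T \<and> x \<in> T \<and> (\<forall>y\<in>T \<inter> C. f y \<in> U))"
    "\<forall>x\<in>C. \<forall>W. open W \<longrightarrow> 0 \<in> W \<longrightarrow>
      (\<exists>T V. open T \<and> x \<in> T \<and> open V \<and> 0 \<in> V \<and> (\<forall>y\<in>T \<inter> C. orbit_bounded a b f V W y))"
proof -
  interpret A: continuous_action a by fact
  interpret B: continuous_action b by fact
  obtain C0 where C0: "\<forall>\<^sub>F x in residual. x \<in> C0"
    "\<forall>x\<in>C0. \<forall>U. open U \<longrightarrow> f x \<in> U \<longrightarrow> (\<exists>T. open T \<and> x \<in> T \<and> (\<forall>y\<in>T \<inter> C0. f y \<in> U))"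
    using f by (rule borel_measurable_continuous_on_residual)
  obtain BX :: "'x set set" where BX: "countable BX" "topological_basis BX"
    using ex_countable_basis by blast
  obtain BK :: "'k set set" where BK: "countable BK" "topological_basis BK"
    using ex_countable_basis by blast
  obtain BL :: "'l set set" where BL: "countable BL" "topological_basis BL"
    using ex_countable_basis by blast
  \<comment> \<open>Since \<open>Q W\<close> is countable, the meager exceptional sets of all its
    pairs can be discarded. The bound then holds at every point of \<open>T \<inter> C\<close>, not
    only generically in \<open>T\<close>.\<close>
  define Q where "Q W = {(T, V). T \<in> BX \<and> V \<in> BK \<and> 0 \<in> V \<and>
    (\<forall>\<^sub>F x in residual. x \<in> T \<longrightarrow> orbit_bounded a b f V W x)}" for W
  have Q_countable: "countable (Q W)" for W
    by (rule countable_subset[of _ "BX \<times> BK"]) (auto simp: Q_def BX BK)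
  have Q_dense: "\<forall>\<^sub>F x in residual. x \<in> \<Union>(fst ` Q W)" if "open W" "0 \<in> W" for W
  proof (rule eventually_residual_dense_open[of "\<Union>(fst ` Q W)"], rule dense_openI)
    show "open (\<Union>(fst ` Q W))"
      using topological_basis_open[OF BX(2)] by (auto simp: Q_def)
    fix U1 :: "'x set" assume U1: "open U1" "U1 \<noteq> {}"
    obtain W1 where W1: "open W1" "0 \<in> W1" "{p. \<exists>w\<in>W1. fst p = b w (snd p)} \<in> sets borel"
      "\<forall>v\<in>W1. \<forall>w\<in>W1. v - w \<in> W"
      using base[OF \<open>open W\<close> \<open>0 \<in> W\<close>] by blast
    obtain U V where UV: "open U" "U \<noteq> {}" "U \<subseteq> U1" "open V" "0 \<in> V"
      "\<forall>\<^sub>F x in residual. x \<in> U \<longrightarrow> orbit_bounded a b f V W x"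
      unfolding orbit_bounded_def
      by (rule orbit_continuity_local[OF assms(1-4) W1(1-3) W1(4)[rule_format] U1])
    obtain x where "x \<in> U"
      using UV(2) by blast
    then obtain T where T: "T \<in> BX" "x \<in> T" "T \<subseteq> U"
      using BX(2) UV(1) by (meson topological_basisE)
    obtain V' where V': "V' \<in> BK" "0 \<in> V'" "V' \<subseteq> V"
      using BK(2) UV(4,5) by (meson topological_basisE)
    have "\<forall>\<^sub>F x in residual. x \<in> T \<longrightarrow> orbit_bounded a b f V' W x"
      using UV(6)
    proof eventually_elim
      case (elim x)
      then show ?case
        unfolding orbit_bounded_def using T(3) V'(3) by (auto elim: eventually_mono)
    qed
    then have "(T, V') \<in> Q W"
      using T V' by (simp add: Q_def)
    then have "x \<in> \<Union>(fst ` Q W)"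
      using T(2) by force
    then show "\<Union>(fst ` Q W) \<inter> U1 \<noteq> {}"
      using \<open>x \<in> U\<close> UV(3) by blast
  qed
  define good where "good x \<longleftrightarrow> x \<in> C0 \<and> (\<forall>W\<in>{W \<in> BL. 0 \<in> W}. x \<in> \<Union>(fst ` Q W) \<and>
    (\<forall>q\<in>Q W. x \<in> fst q \<longrightarrow> orbit_bounded a b f (snd q) W x))" for x
  have good: "\<forall>\<^sub>F x in residual. good x"
    unfolding good_def
  proof (intro eventually_conj C0 eventually_residual_ball_countable Q_countable)
    show "countable {W \<in> BL. 0 \<in> W}"
      using BL(1) by simp
    show "\<forall>\<^sub>F x in residual. x \<in> \<Union>(fst ` Q W)" if "W \<in> {W \<in> BL. 0 \<in> W}" for W
      using Q_dense topological_basis_open[OF BL(2)] that by auto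
    show "\<forall>\<^sub>F x in residual. x \<in> fst q \<longrightarrow> orbit_bounded a b f (snd q) W x" if "q \<in> Q W" for q W
      using that by (auto simp: Q_def)
  qed
  \<comment> \<open>One round of closing off suffices: genericity is invariant under right
    translation, so if generic translates of \<open>x\<close> are good, the same is true of every
    \<open>a g x\<close>.\<close>
  define C where "C = {x. good x \<and> (\<forall>\<^sub>F g in residual. good (a g x))}"
  have "\<forall>\<^sub>F x in residual. \<forall>\<^sub>F g in residual. good (a g x)"
    using Kuratowski_Ulam[OF A.residual_act_pair[OF good]] by simp
  with good have "\<forall>\<^sub>F x in residual. x \<in> C"
    unfolding C_def by eventually_elim simp
  moreover have "\<forall>\<^sub>F g in residual. a g x \<in> C" if "x \<in> C" for x
  proof -
    have *: "\<forall>\<^sub>F g in residual. good (a g x)"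
      using that by (simp add: C_def)
    have "\<forall>\<^sub>F h in residual. good (a h (a g x))" for g
      using residual_add_right[OF *, of g] by (simp add: A.act_add)
    with * show ?thesis
      by (simp add: C_def)
  qed
  moreover have "\<exists>T. open T \<and> x \<in> T \<and> (\<forall>y\<in>T \<inter> C. f y \<in> U)" if x: "x \<in> C" "open U" "f x \<in> U" for x U
  proof -
    have "C \<subseteq> C0"
      by (auto simp: C_def good_def)
    then have "x \<in> C0"
      using x(1) by (rule subsetD)
    then obtain T where "open T" "x \<in> T" "\<forall>y\<in>T \<inter> C0. f y \<in> U"
      using C0(2)[rule_format, OF _ x(2,3)] by metis
    then show ?thesis
      using \<open>C \<subseteq> C0\<close> by (intro exI[of _ T]) auto
  qed
  moreover have "\<exists>T V. open T \<and> x \<in> T \<and> open V \<and> 0 \<in> V \<and> (\<forall>y\<in>T \<inter> C. orbit_bounded a b f V W y)"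
    if x: "x \<in> C" "open W" "0 \<in> W" for x W
  proof -
    obtain W' where W': "W' \<in> BL" "0 \<in> W'" "W' \<subseteq> W"
      using BL(2) x(2,3) by (meson topological_basisE)
    then have "x \<in> \<Union>(fst ` Q W')"
      using x(1) by (simp add: C_def good_def)
    then obtain T V where TV: "(T, V) \<in> Q W'" "x \<in> T"
      by force
    then have "open T" "open V" "0 \<in> V"
      using topological_basis_open BX(2) BK(2) by (auto simp: Q_def)
    moreover have "orbit_bounded a b f V W y" if "y \<in> T \<inter> C" for y
    proof -
      have "orbit_bounded a b f V W' y"
        using that W' TV(1) by (force simp: C_def good_def)
      then show ?thesis
        unfolding orbit_bounded_def using W'(3) by (auto elim!: eventually_mono)
    qed
    ultimately show ?thesis
      using TV(2) by (intro exI[of _ T] exI[of _ V]) simp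
  qed
  ultimately show thesis
    by (intro that[of C]) simp_all
qed

text \<open>The group elements witnessing the relation are perturbed by small generic ones, so that
  the moved points lie in \<open>C\<close> and \<open>f\<close> sends them into the local orbits
  \<open>W f(x)\<close> and \<open>W f(y)\<close>. By \<open>usq_perturb\<close> the moved points
  stay related for a slightly larger neighbourhood, chosen beforehand to be orbit bounded, and the
  induction hypothesis applies.\<close>

lemma usq_orbit_continuous:
  fixes a :: "'k::{topological_group_add, polish_space} \<Rightarrow> 'x::polish_space \<Rightarrow> 'x"
    and b :: "'l::topological_group_add \<Rightarrow> 'y::topological_space \<Rightarrow> 'y"
  assumes "continuous_action a" "continuous_action b"
    and C: "\<forall>x\<in>C. \<forall>\<^sub>F g in residual. a g x \<in> C"
    and cont: "\<forall>x\<in>C. \<forall>U. open U \<longrightarrow> f x \<in> U \<longrightarrow> (\<exists>T. open T \<and> x \<in> T \<and> (\<forall>y\<in>T \<inter> C. f y \<in> U))"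
    and orbit: "\<forall>x\<in>C. \<forall>W. open W \<longrightarrow> 0 \<in> W \<longrightarrow>
      (\<exists>T V. open T \<and> x \<in> T \<and> open V \<and> 0 \<in> V \<and> (\<forall>y\<in>T \<inter> C. orbit_bounded a b f V W y))"
    and "x \<in> C" "y \<in> C" "open V"
    and "orbit_bounded a b f V W x" "orbit_bounded a b f V W y"
    and "usq euclidean 0 a \<alpha> V x y"
  shows "usq euclidean 0 b \<alpha> W (f x) (f y)"
  using assms(6-11)
proof (induction \<alpha> arbitrary: V W x y rule: less_induct)
  case (less \<alpha>)
  interpret A: continuous_action a by fact
  interpret B: continuous_action b by fact
  \<comment> \<open>As \<open>V\<close> and \<open>T\<close> are open, \<open>k + g\<close> still
    does the work of \<open>g\<close> for all \<open>k\<close> close to 0, and a generic one among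
    these can be taken.\<close>
  have pick: "\<exists>k\<in>Z. k + g \<in> V \<and> a (k + g) z \<in> T \<inter> C \<and> (\<exists>w\<in>W. f (a (k + g) z) = b w (f z))"
    if z: "z \<in> C" "orbit_bounded a b f V W z" and g: "g \<in> V" "a g z \<in> T" and "open T" "open Z" "0 \<in> Z"
    for z g T Z
  proof -
    have "\<forall>\<^sub>F k in residual. a k z \<in> C \<and> (k \<in> V \<longrightarrow> (\<exists>w\<in>W. f (a k z) = b w (f z)))"
      using C[rule_format, OF z(1)] z(2) unfolding orbit_bounded_def by (rule eventually_conj)
    from residual_add_right[OF this, of g]
    have gen: "\<forall>\<^sub>F k in residual. a (k + g) z \<in> C \<and>
        (k + g \<in> V \<longrightarrow> (\<exists>w\<in>W. f (a (k + g) z) = b w (f z)))" .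
    have "open (Z \<inter> (\<lambda>k. k + g) -` V \<inter> (\<lambda>k. a (k + g) z) -` T)"
      using \<open>open V\<close> \<open>open T\<close> \<open>open Z\<close>
      by (intro open_Int open_vimage A.continuous_on_act continuous_intros)
    moreover have "0 \<in> Z \<inter> (\<lambda>k. k + g) -` V \<inter> (\<lambda>k. a (k + g) z) -` T"
      using g \<open>0 \<in> Z\<close> by simp
    ultimately obtain k where "k \<in> Z \<inter> (\<lambda>k. k + g) -` V \<inter> (\<lambda>k. a (k + g) z) -` T"
      "a (k + g) z \<in> C \<and> (k + g \<in> V \<longrightarrow> (\<exists>w\<in>W. f (a (k + g) z) = b w (f z)))"
      using residual_Baire[OF gen] by metis
    then show ?thesis
      by blast
  qed
  show ?case
  proof (cases "\<alpha> = 0")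
    case True
    have "f z' \<in> closure ((\<lambda>w. b w (f z)) ` W)"
      if z: "z \<in> C" "orbit_bounded a b f V W z" "z' \<in> C" "z' \<in> closure ((\<lambda>g. a g z) ` V)" for z z'
      unfolding closure_iff_nhds_not_empty
    proof (intro allI impI)
      fix A U assume U: "U \<subseteq> A" "open U" "f z' \<in> U"
      obtain T where T: "open T" "z' \<in> T" "\<forall>y\<in>T \<inter> C. f y \<in> U"
        using cont[rule_format, OF z(3) U(2,3)] by blast
      then obtain g where "g \<in> V" "a g z \<in> T"
        using z(4) unfolding closure_iff_nhds_not_empty by blast
      \<comment> \<open>The translate \<open>a g z\<close> may miss \<open>C\<close>, where nothing
        is known about \<open>f\<close>. A generic perturbation, of any size here, repairs
        this.\<close>
      from pick[OF z(1,2) this T(1) open_UNIV UNIV_I]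
      obtain k w where "a (k + g) z \<in> T \<inter> C" "w \<in> W" "f (a (k + g) z) = b w (f z)"
        by blast
      then have "b w (f z) \<in> U"
        using T(3) by metis
      then show "(\<lambda>w. b w (f z)) ` W \<inter> A \<noteq> {}"
        using U(1) \<open>w \<in> W\<close> by blast
    qed
    then show ?thesis
      using less.prems True by (simp add: usq_zero)
  next
    case False
    show ?thesis
      unfolding usq_pos[OF False]
    proof (intro allI impI)
      fix W' :: "'l set" and U :: "'y set"
      assume "openin euclidean W' \<and> 0 \<in> W' \<and> open U \<and> (f x \<in> U \<or> f y \<in> U)"
      then have W': "open W'" "0 \<in> W'" and "open U" and "f x \<in> U \<or> f y \<in> U"
        by auto
      \<comment> \<open>Both points will be moved close to \<open>z\<close>, so continuity and orbit
        boundedness near this single point control both.\<close>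
      then obtain z where z: "z \<in> {x, y}" "f z \<in> U"
        by blast
      then have "z \<in> C"
        using less.prems(1,2) by blast
      obtain T1 where T1: "open T1" "z \<in> T1" "\<forall>y\<in>T1 \<inter> C. f y \<in> U"
        using cont[rule_format, OF \<open>z \<in> C\<close> \<open>open U\<close> z(2)] by blast
      obtain T2 V2 where T2: "open T2" "z \<in> T2" "open V2" "0 \<in> V2"
        "\<forall>y\<in>T2 \<inter> C. orbit_bounded a b f V2 W' y"
        using orbit[rule_format, OF \<open>z \<in> C\<close> W'] by blast
      \<comment> \<open>Continuity at 0 gives \<open>V3\<close> and \<open>Z\<close> with
        \<open>Z + V3 - Z\<close> inside \<open>V2\<close>: the relation is requested for
        \<open>V3\<close>, and after perturbation by elements of \<open>Z\<close> it holds for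
        \<open>V2\<close>.\<close>
      have "open ((\<lambda>(r, v, s). r + v - s) -` V2)"
        by (intro open_vimage T2(3)) (auto simp: case_prod_unfold intro!: continuous_intros)
      moreover have "(0, 0, 0) \<in> (\<lambda>(r, v, s). r + v - s) -` V2"
        using T2(4) by simp
      ultimately obtain R P where R: "open R" "0 \<in> R" "open P" "(0, 0) \<in> P"
        "R \<times> P \<subseteq> (\<lambda>(r, v, s). r + v - s) -` V2"
        by (metis open_prod_elim mem_Sigma_iff)
      obtain V3 S where S: "open V3" "0 \<in> V3" "open S" "0 \<in> S" "V3 \<times> S \<subseteq> P"
        by (metis open_prod_elim mem_Sigma_iff R(3,4))
      define Z where "Z = R \<inter> S"
      have Z: "open Z" "0 \<in> Z"
        using R S by (auto simp: Z_def)
      have V3: "r + v - s \<in> V2" if "r \<in> Z" "v \<in> V3" "s \<in> Z" for r v s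
      proof -
        have "(r, v, s) \<in> R \<times> P"
          using S(5) that by (auto simp: Z_def)
        with R(5) have "(r, v, s) \<in> (\<lambda>(r, v, s). r + v - s) -` V2"
          by (rule subsetD)
        then show ?thesis
          by simp
      qed
      have "openin euclidean V3 \<and> 0 \<in> V3 \<and> open (T1 \<inter> T2) \<and> (x \<in> T1 \<inter> T2 \<or> y \<in> T1 \<inter> T2)"
        using S T1 T2 z(1) by auto
      then obtain gx gy where g: "gx \<in> V" "gy \<in> V" "a gx x \<in> T1 \<inter> T2" "a gy y \<in> T1 \<inter> T2"
        "\<forall>\<beta><\<alpha>. usq euclidean 0 a \<beta> V3 (a gx x) (a gy y)"
        using less.prems(6) unfolding usq_pos[OF False] by metis
      have T: "open (T1 \<inter> T2)"
        using T1 T2 by auto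
      obtain k u where k: "k \<in> Z" "k + gx \<in> V" "a (k + gx) x \<in> T1 \<inter> T2 \<inter> C" "u \<in> W"
        "f (a (k + gx) x) = b u (f x)"
        using pick[OF less.prems(1,4) g(1,3) T Z] by blast
      obtain l v where l: "l \<in> Z" "l + gy \<in> V" "a (l + gy) y \<in> T1 \<inter> T2 \<inter> C" "v \<in> W"
        "f (a (l + gy) y) = b v (f y)"
        using pick[OF less.prems(2,5) g(2,4) T Z] by blast
      have "usq euclidean 0 b \<beta> W' (f (a (k + gx) x)) (f (a (l + gy) y))" if "\<beta> < \<alpha>" for \<beta>
      proof (rule less.IH[OF that _ _ T2(3)])
        show "a (k + gx) x \<in> C" "a (l + gy) y \<in> C"
          using k l by auto
        show "orbit_bounded a b f V2 W' (a (k + gx) x)" "orbit_bounded a b f V2 W' (a (l + gy) y)"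
          using k(3) l(3) T2(5) by auto
        show "usq euclidean 0 a \<beta> V2 (a (k + gx) x) (a (l + gy) y)"
          unfolding A.act_add
          by (rule A.usq_perturb[of _ V3]) (use g(5) that V3 k(1) l(1) in auto)
      qed
      moreover have "b u (f x) \<in> U" "b v (f y) \<in> U"
        using k(3,5) l(3,5) T1(3) by (metis IntD1 IntD2 IntI)+
      ultimately show "\<exists>gx\<in>W. \<exists>gy\<in>W. b gx (f x) \<in> U \<and> b gy (f y) \<in> U \<and>
          (\<forall>\<beta><\<alpha>. usq euclidean 0 b \<beta> W' (b gx (f x)) (b gy (f y)))"
        using k(4,5) l(4,5) by (intro bexI[of _ u] bexI[of _ v]) auto
    qed
  qed
qed

text \<open>The relation sees the group only through its open sets, its identity and its action.
  With injectivity, the first assumption makes \<open>\<phi>\<close> a homeomorphism from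
  \<open>K'\<close> onto \<open>K\<close>.\<close>

lemma usq_transfer:
  assumes openin: "\<And>W. openin K W \<longleftrightarrow> (\<exists>W'. openin K' W' \<and> W = \<phi> ` W')"
    and "inj \<phi>" "\<phi> e' = e"
  shows "usq K e act \<alpha> (\<phi> ` V) x y \<longleftrightarrow> usq K' e' (\<lambda>g. act (\<phi> g)) \<alpha> V x y"
proof (induction \<alpha> arbitrary: V x y rule: less_induct)
  case (less \<alpha>)
  show ?case
  proof (cases "\<alpha> = 0")
    case True
    then show ?thesis
      by (simp add: usq_zero image_image)
  next
    case False
    have mem: "e \<in> \<phi> ` W \<longleftrightarrow> e' \<in> W" for W
      using assms(2,3) by (metis inj_image_mem_iff)
    have IH: "(\<forall>\<beta><\<alpha>. usq K e act \<beta> (\<phi> ` W) u v) \<longleftrightarrow> (\<forall>\<beta><\<alpha>. usq K' e' (\<lambda>g. act (\<phi> g)) \<beta> W u v)"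
      for W u v
      using less.IH by blast
    have all: "(\<forall>W U. openin K W \<and> e \<in> W \<and> R U \<longrightarrow> S W U) \<longleftrightarrow>
        (\<forall>W U. openin K' W \<and> e' \<in> W \<and> R U \<longrightarrow> S (\<phi> ` W) U)" for R S
      unfolding openin mem[symmetric] by blast
    show ?thesis
      unfolding usq_pos[OF False] all[of "\<lambda>U. open U \<and> (x \<in> U \<or> y \<in> U)"] IH bex_simps
      by simp
  qed
qed

subsection \<open>The group of convergent sequences\<close>

text \<open>As a type of its own, the group \<open>c(G)\<close> can be an instance of the classes
  demanded by the category arguments.\<close>

typedef (overloaded) 'g conv_seq = "cseq :: (nat \<Rightarrow> 'g::{topological_group_add, polish_space}) set"
  morphisms seq Abs_conv_seq
proof
  show "(\<lambda>_. 0) \<in> cseq"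
    by (simp add: cseq_def convergent_const)
qed

lemma convergent_seq: "convergent (seq a)"
  using seq[of a] by (simp add: cseq_def)

lemma seq_Abs: "convergent u \<Longrightarrow> seq (Abs_conv_seq u) = u"
  by (simp add: Abs_conv_seq_inverse cseq_def)

lemma conv_seq_eqI:
  assumes "\<And>n. seq a n = seq b n"
  shows "a = b"
  using assms by (simp add: seq_inject[symmetric] fun_eq_iff)

section \<open>The supremum metric on \<open>conv_seq\<close> is Polish\<close>

instantiation conv_seq :: ("{topological_group_add, polish_space}") metric_space
begin

definition dist_conv_seq :: "'a conv_seq \<Rightarrow> 'a conv_seq \<Rightarrow> real"
  where "dist_conv_seq a b = dist_u (seq a) (seq b)"

definition uniformity_conv_seq :: "('a conv_seq \<times> 'a conv_seq) filter"
  where "uniformity_conv_seq = (INF e\<in>{0 <..}. principal {(x, y). dist x y < e})"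

definition open_conv_seq :: "'a conv_seq set \<Rightarrow> bool"
  where "open_conv_seq S = (\<forall>x\<in>S. \<forall>\<^sub>F (x', y) in uniformity. x' = x \<longrightarrow> y \<in> S)"

instance
proof
  interpret Metric_space cseq "dist_u :: (nat \<Rightarrow> 'a) \<Rightarrow> _"
    by (rule Metric_space_cseq)
  fix x y z :: "'a conv_seq"
  show "dist x y = 0 \<longleftrightarrow> x = y"
    unfolding dist_conv_seq_def using zero seq seq_inject by blast
  show "dist x y \<le> dist x z + dist y z"
    unfolding dist_conv_seq_def using triangle[of "seq x" "seq z" "seq y"] seq commute by metis
qed (simp_all add: uniformity_conv_seq_def open_conv_seq_def)

end

lemma dist_seq_le: "dist (seq a n) (seq b n) \<le> dist a b"
  using seq[of a] seq[of b] unfolding dist_conv_seq_def dist_u_def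
  by (auto intro: cSUP_upper bdd_above_dist_cseq)

lemma dist_conv_seq_le:
  assumes "\<And>n. dist (seq a n) (seq b n) \<le> e"
  shows "dist a b \<le> e"
  using seq[of a] seq[of b] assms unfolding dist_conv_seq_def dist_u_def
  by (auto intro: cSUP_least)

text \<open>Completeness of the underlying group enters twice: it gives the uniform limit
  \<open>l\<close>, and it makes \<open>l\<close> convergent, since a uniform limit of Cauchy
  sequences is Cauchy.\<close>

instance conv_seq :: ("{topological_group_add, polish_space}") complete_space
proof
  fix X :: "nat \<Rightarrow> 'a conv_seq"
  assume X: "Cauchy X"
  have "\<exists>N. \<forall>m n x. N \<le> m \<and> N \<le> n \<and> True \<longrightarrow> dist (seq (X m) x) (seq (X n) x) < e" if "e > 0" for e
  proof -
    obtain N where "\<forall>m\<ge>N. \<forall>n\<ge>N. dist (X m) (X n) < e"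
      using X \<open>e > 0\<close> unfolding Cauchy_def by blast
    then show ?thesis
      by (metis dist_seq_le le_less_trans)
  qed
  then obtain l where l: "\<And>e. e > 0 \<Longrightarrow> \<exists>N. \<forall>n x. N \<le> n \<and> True \<longrightarrow> dist (seq (X n) x) (l x) < e"
    using uniformly_convergent_eq_cauchy[of "\<lambda>_. True" "\<lambda>n. seq (X n)"] by blast
  have "Cauchy l"
  proof (rule metric_CauchyI)
    fix e :: real assume "e > 0"
    then obtain k where k: "\<And>x. dist (seq (X k) x) (l x) < e / 3"
      using l[of "e / 3"] by auto
    obtain M where M: "\<And>m n. m \<ge> M \<Longrightarrow> n \<ge> M \<Longrightarrow> dist (seq (X k) m) (seq (X k) n) < e / 3"
      using metric_CauchyD[OF convergent_Cauchy[OF convergent_seq], of "e / 3" "X k"] \<open>e > 0\<close> by auto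
    have "dist (l m) (l n) < e" if "m \<ge> M" "n \<ge> M" for m n
      using k[of m] k[of n] M[OF that] dist_triangle[of "l m" "l n" "seq (X k) m"]
        dist_triangle[of "seq (X k) m" "l n" "seq (X k) n"] by (simp add: dist_commute)
    then show "\<exists>M. \<forall>m\<ge>M. \<forall>n\<ge>M. dist (l m) (l n) < e"
      by blast
  qed
  then have seq_l: "seq (Abs_conv_seq l) = l"
    by (intro seq_Abs) (simp add: Cauchy_convergent_iff)
  have "X \<longlonglongrightarrow> Abs_conv_seq l"
  proof (rule metric_LIMSEQ_I)
    fix e :: real assume "e > 0"
    then obtain N where N: "\<And>n x. n \<ge> N \<Longrightarrow> dist (seq (X n) x) (l x) < e / 2"
      using l[of "e / 2"] by auto
    have "dist (X n) (Abs_conv_seq l) < e" if "n \<ge> N" for n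
    proof -
      have "dist (X n) (Abs_conv_seq l) \<le> e / 2"
        using N[OF that] by (intro dist_conv_seq_le) (simp add: seq_l less_imp_le)
      then show ?thesis
        using \<open>e > 0\<close> by simp
    qed
    then show "\<exists>N. \<forall>n\<ge>N. dist (X n) (Abs_conv_seq l) < e"
      by blast
  qed
  then show "convergent X"
    by (rule convergentI)
qed

lemma second_countable_if_separable:
  fixes D :: "'a::metric_space set"
  assumes "countable D" and dense: "\<And>x e. e > 0 \<Longrightarrow> \<exists>d\<in>D. dist d x < e"
  shows "\<exists>B::'a set set. countable B \<and> open = generate_topology B"
proof -
  define B where "B = (\<lambda>(d, m). ball d (inverse (real (Suc m)))) ` (D \<times> (UNIV :: nat set))"
  have "topological_basis B"
  proof (rule topological_basisI)
    fix U and x :: 'a assume "open U" "x \<in> U"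
    then obtain e where e: "e > 0" "ball x e \<subseteq> U"
      using open_contains_ball by blast
    obtain m where m: "inverse (real (Suc m)) < e / 2"
      using reals_Archimedean[of "e / 2"] e(1) by auto
    obtain d where d: "d \<in> D" "dist d x < inverse (real (Suc m))"
      using dense[of "inverse (real (Suc m))"] by auto
    have "ball d (inverse (real (Suc m))) \<subseteq> ball x e"
    proof
      fix y assume "y \<in> ball d (inverse (real (Suc m)))"
      then show "y \<in> ball x e"
        using d(2) m dist_triangle[of x y d] by (simp add: dist_commute)
    qed
    moreover have "ball d (inverse (real (Suc m))) \<in> B"
      unfolding B_def using d(1) by force
    ultimately show "\<exists>B'\<in>B. x \<in> B' \<and> B' \<subseteq> U"
      using d(2) e(2) by (intro bexI[of _ "ball d (inverse (real (Suc m)))"]) auto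
  qed (auto simp: B_def)
  moreover have "countable B"
    unfolding B_def using assms(1) by auto
  ultimately show ?thesis
    using topological_basis_imp_subbasis by blast
qed

text \<open>Up to a uniformly small error a convergent sequence is eventually constant, so the
  eventually constant sequences over a countable dense set form a countable dense set.\<close>

instance conv_seq :: ("{topological_group_add, polish_space}") second_countable_topology
proof
  obtain Q :: "'a set" where Q: "countable Q" "\<forall>X. open X \<longrightarrow> X \<noteq> {} \<longrightarrow> (\<exists>d\<in>Q. d \<in> X)"
    using countable_dense_exists by blast
  have near: "\<exists>q\<in>Q. dist q x < e" if "e > 0" for x e
  proof -
    have "x \<in> ball x e"
      using that by simp
    then obtain q where "q \<in> Q" "q \<in> ball x e"
      using Q(2) by (metis open_ball empty_iff)
    then show ?thesis
      by (auto simp: dist_commute)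
  qed
  define ext where "ext p = (\<lambda>n. if n < length (fst p) then fst p ! n else snd p)" for p :: "'a list \<times> 'a"
  have conv: "convergent (ext p)" for p
  proof -
    have "\<forall>\<^sub>F n in sequentially. ext p n = snd p"
      using eventually_ge_at_top[of "length (fst p)"] by eventually_elim (simp add: ext_def)
    then show ?thesis
      by (intro convergentI[OF tendsto_eventually])
  qed
  show "\<exists>B::'a conv_seq set set. countable B \<and> open = generate_topology B"
  proof (rule second_countable_if_separable)
    show "countable ((\<lambda>p. Abs_conv_seq (ext p)) ` (lists Q \<times> Q))"
      using Q(1) by (intro countable_image countable_SIGMA countable_lists)
    fix x :: "'a conv_seq" and e :: real assume "e > 0"
    obtain l where "seq x \<longlonglongrightarrow> l"
      using convergent_seq by (auto simp: convergent_def)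
    then obtain N where N: "\<And>n. n \<ge> N \<Longrightarrow> dist (seq x n) l < e / 4"
      using metric_LIMSEQ_D[of "seq x" l "e / 4"] \<open>e > 0\<close> by auto
    obtain c where c: "c \<in> Q" "dist c l < e / 4"
      using near[of "e / 4" l] \<open>e > 0\<close> by auto
    obtain q where q: "\<And>n. q n \<in> Q" "\<And>n. dist (q n) (seq x n) < e / 4"
      using near[of "e / 4" "seq x n" for n] \<open>e > 0\<close> by (metis divide_pos_pos zero_less_numeral)
    \<comment> \<open>The first \<open>N\<close> terms follow \<open>x\<close> one by one; the tail
      is the single value \<open>c\<close> near the limit.\<close>
    define p where "p = (map q [0..<N], c)"
    have "p \<in> lists Q \<times> Q"
      using q(1) c(1) by (auto simp: p_def)
    moreover have "dist (Abs_conv_seq (ext p)) x < e"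
    proof -
      have "dist (ext p n) (seq x n) \<le> e / 2" for n
      proof (cases "n < N")
        case True
        then show ?thesis
          using q(2)[of n] \<open>e > 0\<close> by (simp add: ext_def p_def)
      next
        case False
        then show ?thesis
          using c(2) N[of n] dist_triangle2[of c "seq x n" l] by (simp add: ext_def p_def)
      qed
      then have "dist (Abs_conv_seq (ext p)) x \<le> e / 2"
        by (intro dist_conv_seq_le) (simp add: seq_Abs conv)
      then show ?thesis
        using \<open>e > 0\<close> by simp
    qed
    ultimately show "\<exists>d\<in>(\<lambda>p. Abs_conv_seq (ext p)) ` (lists Q \<times> Q). dist d x < e"
      by blast
  qed
qed

instance conv_seq :: ("{topological_group_add, polish_space}") polish_space ..

text \<open>A convergent sequence with its limit is compact: the modulus of continuity at the limit
  serves a whole tail, and finitely many terms remain. This replaces uniform continuity of the group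
  operations, which may fail, when their continuity in the supremum metric is shown.\<close>

lemma continuous_equicontinuous_along_convergent:
  fixes h :: "'a::metric_space \<Rightarrow> 'b::metric_space"
  assumes h: "continuous_on UNIV h" and "convergent u" "e > 0"
  obtains d where "d > 0" "\<forall>n y. dist y (u n) < d \<longrightarrow> dist (h y) (h (u n)) < e"
proof -
  have cont: "\<exists>d>0. \<forall>y. dist y x < d \<longrightarrow> dist (h y) (h x) < r" if "r > 0" for x r
    using h that unfolding continuous_on_iff by auto
  obtain l where "u \<longlonglongrightarrow> l"
    using assms(2) by (auto simp: convergent_def)
  obtain d0 where d0: "d0 > 0" "\<And>y. dist y l < d0 \<Longrightarrow> dist (h y) (h l) < e / 2"
    using cont[of "e / 2" l] \<open>e > 0\<close> by auto
  obtain N where N: "\<And>n. n \<ge> N \<Longrightarrow> dist (u n) l < d0 / 2"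
    using metric_LIMSEQ_D[OF \<open>u \<longlonglongrightarrow> l\<close>, of "d0 / 2"] d0(1) by auto
  have "\<forall>n. \<exists>d>0. \<forall>y. dist y (u n) < d \<longrightarrow> dist (h y) (h (u n)) < e"
    using cont[OF \<open>e > 0\<close>] by blast
  then obtain d where d: "\<forall>n. d n > 0 \<and> (\<forall>y. dist y (u n) < d n \<longrightarrow> dist (h y) (h (u n)) < e)"
    by (rule choice[THEN exE])
  \<comment> \<open>Half of \<open>d0\<close> suits the tail, whose terms are themselves within
    \<open>d0 / 2\<close> of the limit.\<close>
  define r where "r = Min (insert (d0 / 2) (d ` {..<N}))"
  show thesis
  proof
    show "r > 0"
      unfolding r_def using d0 d by (subst Min_gr_iff) auto
    have "dist (h y) (h (u n)) < e" if y: "dist y (u n) < r" for n y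
    proof (cases "n < N")
      case True
      then have "r \<le> d n"
        unfolding r_def by (intro Min_le) auto
      then show ?thesis
        using y d by simp
    next
      case False
      have "r \<le> d0 / 2"
        unfolding r_def by (intro Min_le) auto
      then have "dist y l < d0"
        using y N[of n] False dist_triangle[of y l "u n"] by simp
      moreover have "dist (u n) l < d0"
        using N[of n] False d0(1) by simp
      ultimately show ?thesis
        using d0(2) dist_triangle2[of "h y" "h (u n)" "h l"] by (smt (verit) field_sum_of_halves)
    qed
    then show "\<forall>n y. dist y (u n) < r \<longrightarrow> dist (h y) (h (u n)) < e"
      by blast
  qed
qed

instantiation conv_seq :: ("{topological_group_add, polish_space}") topological_group_add
begin

definition zero_conv_seq :: "'a conv_seq"
  where "0 = Abs_conv_seq (\<lambda>_. 0)"

definition plus_conv_seq :: "'a conv_seq \<Rightarrow> 'a conv_seq \<Rightarrow> 'a conv_seq"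
  where "a + b = Abs_conv_seq (\<lambda>n. seq a n + seq b n)"

definition uminus_conv_seq :: "'a conv_seq \<Rightarrow> 'a conv_seq"
  where "- a = Abs_conv_seq (\<lambda>n. - seq a n)"

definition minus_conv_seq :: "'a conv_seq \<Rightarrow> 'a conv_seq \<Rightarrow> 'a conv_seq"
  where "a - b = Abs_conv_seq (\<lambda>n. seq a n - seq b n)"

lemma seq_simps [simp]:
  "seq (0 :: 'a conv_seq) n = 0"
  "seq (a + b) n = seq a n + seq b n"
  "seq (- a) n = - seq a n"
  "seq (a - b) n = seq a n - seq b n" for a b :: "'a conv_seq"
proof -
  obtain s t where "seq a \<longlonglongrightarrow> s" "seq b \<longlonglongrightarrow> t"
    using convergent_seq unfolding convergent_def by metis
  then have "convergent (\<lambda>n. seq a n + seq b n)" "convergent (\<lambda>n. - seq a n)"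
    "convergent (\<lambda>n. seq a n - seq b n)"
    unfolding convergent_def by (blast intro: tendsto_add tendsto_minus tendsto_diff)+
  then show "seq (0 :: 'a conv_seq) n = 0" "seq (a + b) n = seq a n + seq b n"
    "seq (- a) n = - seq a n" "seq (a - b) n = seq a n - seq b n"
    by (simp_all add: zero_conv_seq_def plus_conv_seq_def uminus_conv_seq_def minus_conv_seq_def
        seq_Abs convergent_const)
qed

instance
proof
  fix a b c :: "'a conv_seq"
  show "a + b + c = a + (b + c)" "0 + a = a" "a + 0 = a" "- a + a = 0" "a + - b = a - b"
    by (rule conv_seq_eqI, simp add: add.assoc)+
  show "((\<lambda>x. fst x + snd x) \<longlongrightarrow> a + b) (nhds a \<times>\<^sub>F nhds b)"
  proof (rule tendstoI)
    fix e :: real assume "e > 0"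
    have conv: "convergent (\<lambda>n. (seq a n, seq b n))"
      using convergent_seq[of a] convergent_seq[of b] unfolding convergent_def
      by (blast intro: tendsto_Pair)
    have cont: "continuous_on UNIV (\<lambda>p. fst p + snd p :: 'a)"
      by (intro continuous_intros)
    \<comment> \<open>The target is \<open>e / 2\<close> because a supremum preserves only \<le>;
      each coordinate gets \<open>d / 2\<close> because the product distance is at most the
      sum.\<close>
    have "e / 2 > 0"
      using \<open>e > 0\<close> by simp
    then obtain d where d: "d > 0" "\<forall>n y. dist y (seq a n, seq b n) < d \<longrightarrow>
        dist (fst y + snd y) (fst (seq a n, seq b n) + snd (seq a n, seq b n)) < e / 2"
      by (rule continuous_equicontinuous_along_convergent[OF cont conv])
    have "\<forall>\<^sub>F x in nhds c. dist x c < d / 2" for c :: "'a conv_seq"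
      unfolding eventually_nhds_metric using d(1) by (intro exI[of _ "d / 2"]) simp
    then have "\<forall>\<^sub>F x in nhds a \<times>\<^sub>F nhds b. dist (fst x) a < d / 2 \<and> dist (snd x) b < d / 2"
      by (intro eventually_prodI)
    then show "\<forall>\<^sub>F x in nhds a \<times>\<^sub>F nhds b. dist (fst x + snd x) (a + b) < e"
    proof eventually_elim
      case (elim x)
      have "dist (fst x + snd x) (a + b) \<le> e / 2"
      proof (rule dist_conv_seq_le)
        fix n
        have "dist (seq (fst x) n, seq (snd x) n) (seq a n, seq b n) \<le>
            dist (seq (fst x) n) (seq a n) + dist (seq (snd x) n) (seq b n)"
          unfolding dist_Pair_Pair by (rule sqrt_sum_squares_le_sum) auto
        also have "\<dots> < d"
          using elim dist_seq_le[of "fst x" n a] dist_seq_le[of "snd x" n b] by linarith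
        finally show "dist (seq (fst x + snd x) n) (seq (a + b) n) \<le> e / 2"
          using d(2)[rule_format, of "(seq (fst x) n, seq (snd x) n)" n] by simp
      qed
      then show ?case
        using \<open>e > 0\<close> by simp
    qed
  qed
  show "(uminus \<longlongrightarrow> - a) (nhds a)"
  proof (rule tendstoI)
    fix e :: real assume "e > 0"
    then have "e / 2 > 0"
      by simp
    have cont: "continuous_on UNIV (uminus :: 'a \<Rightarrow> 'a)"
      by (intro continuous_intros)
    obtain d where
      d: "d > 0" "\<forall>n y. dist y (seq a n) < d \<longrightarrow> dist (- y) (- seq a n) < e / 2"
      using \<open>e / 2 > 0\<close> by (rule continuous_equicontinuous_along_convergent[OF cont convergent_seq])
    have "\<forall>\<^sub>F x in nhds a. dist x a < d"
      unfolding eventually_nhds_metric using d(1) by (intro exI[of _ d]) simp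
    then show "\<forall>\<^sub>F x in nhds a. dist (- x) (- a) < e"
    proof eventually_elim
      case (elim x)
      have "dist (- x) (- a) \<le> e / 2"
      proof (rule dist_conv_seq_le)
        fix n
        show "dist (seq (- x) n) (seq (- a) n) \<le> e / 2"
          using elim dist_seq_le[of x n a] d(2)[rule_format, of "seq x n" n] by simp
      qed
      then show ?case
        using \<open>e > 0\<close> by simp
    qed
  qed
qed

end

section \<open>Comparison with \<open>cseq_topology\<close>, and Borel local orbits\<close>

lemma openin_cseq_topology_iff:
  "openin cseq_topology W \<longleftrightarrow> (\<exists>W'. openin euclidean W' \<and> W = seq ` W')"
proof -
  interpret Metric_space cseq "dist_u :: (nat \<Rightarrow> 'a) \<Rightarrow> _"
    by (rule Metric_space_cseq)
  \<comment> \<open>Since \<open>seq\<close> is an isometry onto \<open>cseq\<close>, balls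
    correspond to balls.\<close>
  have ball: "mball (seq a) r = seq ` ball a r" for a :: "'a conv_seq" and r
  proof (intro equalityI subsetI)
    fix u assume "u \<in> mball (seq a) r"
    then show "u \<in> seq ` ball a r"
      by (intro image_eqI[of _ _ "Abs_conv_seq u"]) (auto simp: dist_conv_seq_def Abs_conv_seq_inverse)
  qed (auto simp: dist_conv_seq_def seq)
  have seq_ball: "seq ` ball a r \<subseteq> seq ` W' \<longleftrightarrow> ball a r \<subseteq> W'" for a :: "'a conv_seq" and r W'
    by (rule inj_image_subset_iff) (simp add: inj_def seq_inject)
  have iff: "openin cseq_topology (seq ` W') \<longleftrightarrow> open W'" for W' :: "'a conv_seq set"
  proof -
    have "openin cseq_topology (seq ` W') \<longleftrightarrow> (\<forall>a\<in>W'. \<exists>r>0. mball (seq a) r \<subseteq> seq ` W')"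
      unfolding cseq_topology_def openin_mtopology using seq by blast
    then show ?thesis
      by (simp add: ball seq_ball open_contains_ball)
  qed
  show ?thesis
  proof
    assume W: "openin cseq_topology W"
    then have "W \<subseteq> cseq"
      using openin_subset topspace_cseq_topology by blast
    then have "W = seq ` Abs_conv_seq ` W"
      by (force simp: image_image Abs_conv_seq_inverse)
    then show "\<exists>W'. openin euclidean W' \<and> W = seq ` W'"
      using W iff by (metis open_openin)
  qed (use iff in auto)
qed

lemma usq_cseq_iff:
  "usq cseq_topology (\<lambda>_. 0) cseq_act \<alpha> cseq x y \<longleftrightarrow>
    usq euclidean 0 (\<lambda>g. cseq_act (seq g)) \<alpha> UNIV x y"
proof -
  have "usq cseq_topology (\<lambda>_. 0) cseq_act \<alpha> (seq ` UNIV) x y \<longleftrightarrow>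
      usq euclidean 0 (\<lambda>g. cseq_act (seq g)) \<alpha> UNIV x y"
    by (rule usq_transfer[OF openin_cseq_topology_iff]) (auto simp: inj_def seq_inject)
  then show ?thesis
    by (simp add: type_definition.Rep_range[OF type_definition_conv_seq])
qed

lemma continuous_action_conv_seq:
  "continuous_action (\<lambda>g. cseq_act (seq (g :: 'g::{topological_group_add, polish_space} conv_seq)))"
proof
  have "continuous_on UNIV (\<lambda>g :: 'g conv_seq. seq g n)" for n
    unfolding continuous_on_iff using dist_seq_le le_less_trans by blast
  then have "continuous_on UNIV (\<lambda>p. seq (fst p :: 'g conv_seq) n)" for n
    by (rule continuous_on_compose2) (auto intro: continuous_intros)
  moreover have "continuous_on UNIV (\<lambda>p. snd p n)" for n
    by (rule continuous_on_compose2[OF continuous_on_product_coordinates]) (auto intro: continuous_intros)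
  ultimately show "continuous_on UNIV (\<lambda>p. cseq_act (seq (fst p :: 'g conv_seq)) (snd p))"
    unfolding cseq_act_def by (intro continuous_on_coordinatewise_then_product continuous_intros)
qed (auto simp: cseq_act_def add.assoc)

text \<open>The action is free: \<open>w\<close> can only be the sequence of differences
  \<open>u n p\<close>, so no projection along the group occurs. By completeness it converges iff it
  is Cauchy, and a supremum below \<open>e\<close> is expressed by a bound
  \<open>e - inverse (real (Suc m))\<close> for some \<open>m\<close>.\<close>

lemma borel_orbit_ball:
  fixes e :: real
  shows "{p. \<exists>w\<in>ball (0 :: 'g::{topological_group_add, polish_space} conv_seq) e.
    fst p = cseq_act (seq w) (snd p)} \<in> sets borel" (is "?R \<in> _")
proof -
  define u where "u n p = fst p n - snd p n" for n and p :: "(nat \<Rightarrow> 'g) \<times> (nat \<Rightarrow> 'g)"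
  have "continuous_on UNIV (\<lambda>p :: (nat \<Rightarrow> 'g) \<times> (nat \<Rightarrow> 'g). fst p n)"
    "continuous_on UNIV (\<lambda>p :: (nat \<Rightarrow> 'g) \<times> (nat \<Rightarrow> 'g). snd p n)" for n
    by (rule continuous_on_compose2[OF continuous_on_product_coordinates];
        auto intro: continuous_intros)+
  then have u [measurable]: "u n \<in> borel \<rightarrow>\<^sub>M borel" for n
    unfolding u_def by (intro borel_measurable_continuous_onI continuous_intros)
  have "?R = {p \<in> space borel. Cauchy (\<lambda>n. u n p)} \<inter>
      {p \<in> space borel. \<exists>m. \<forall>n. dist (u n p) 0 \<le> e - inverse (real (Suc m))}"
  proof (intro equalityI subsetI)
    fix p assume "p \<in> ?R"
    then obtain w :: "'g conv_seq" where w: "dist 0 w < e" "fst p = cseq_act (seq w) (snd p)"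
      by auto
    then have eq: "(\<lambda>n. u n p) = seq w"
      by (simp add: u_def cseq_act_def)
    then have "Cauchy (\<lambda>n. u n p)"
      using convergent_Cauchy convergent_seq by metis
    moreover obtain m where "inverse (real (Suc m)) < e - dist 0 w"
      using reals_Archimedean[of "e - dist 0 w"] w(1) by auto
    then have "dist (u n p) 0 \<le> e - inverse (real (Suc m))" for n
      using dist_seq_le[of w n 0] fun_cong[OF eq, of n] by (simp add: dist_commute)
    ultimately show "p \<in> {p \<in> space borel. Cauchy (\<lambda>n. u n p)} \<inter>
      {p \<in> space borel. \<exists>m. \<forall>n. dist (u n p) 0 \<le> e - inverse (real (Suc m))}"
      by auto
  next
    fix p assume "p \<in> {p \<in> space borel. Cauchy (\<lambda>n. u n p)} \<inter>
      {p \<in> space borel. \<exists>m. \<forall>n. dist (u n p) 0 \<le> e - inverse (real (Suc m))}"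
    then obtain m where p: "Cauchy (\<lambda>n. u n p)" "\<And>n. dist (u n p) 0 \<le> e - inverse (real (Suc m))"
      by auto
    define w where "w = Abs_conv_seq (\<lambda>n. u n p)"
    have w: "seq w = (\<lambda>n. u n p)"
      unfolding w_def using p(1) by (intro seq_Abs) (simp add: Cauchy_convergent_iff)
    have "dist w 0 \<le> e - inverse (real (Suc m))"
      using p(2) by (intro dist_conv_seq_le) (simp add: w)
    moreover have "inverse (real (Suc m)) > 0"
      by simp
    ultimately have "w \<in> ball 0 e"
      by (simp add: dist_commute del: inverse_positive_iff_positive)
    moreover have "fst p = cseq_act (seq w) (snd p)"
      by (simp add: w cseq_act_def u_def)
    ultimately show "p \<in> ?R"
      by blast
  qed
  also have "\<dots> \<in> sets borel"
    by measurable
  finally show ?thesis .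
qed

lemma conv_seq_borel_orbit_base:
  fixes W :: "'g::{topological_group_add, polish_space} conv_seq set"
  assumes "open W" "0 \<in> W"
  shows "\<exists>W1. open W1 \<and> 0 \<in> W1 \<and>
    {p. \<exists>w\<in>W1. fst p = cseq_act (seq w) (snd p)} \<in> sets borel \<and> (\<forall>v\<in>W1. \<forall>w\<in>W1. v - w \<in> W)"
proof -
  have "open ((\<lambda>p. fst p - snd p) -` W)"
    by (intro open_vimage assms continuous_intros)
  then obtain A B where AB: "open A" "open B" "(0, 0) \<in> A \<times> B" "A \<times> B \<subseteq> (\<lambda>p. fst p - snd p) -` W"
    using assms(2) by (elim open_prod_elim[where x = "(0, 0)"]) auto
  then have "open (A \<inter> B)" "0 \<in> A \<inter> B"
    by auto
  then obtain e where e: "e > 0" "ball 0 e \<subseteq> A \<inter> B"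
    using open_contains_ball_eq by blast
  have "v - w \<in> W" if "v \<in> ball 0 e" "w \<in> ball 0 e" for v w
    using AB(4) e(2) that by (auto simp: subset_eq)
  then show ?thesis
    using e(1) borel_orbit_ball[of e] by (intro exI[of _ "ball 0 e"]) auto
qed

section \<open>Transport of a witness along a Borel reduction\<close>

theorem theorem1p4:
  fixes \<alpha> :: omega1
  assumes "0 < \<alpha>"
    and "unbalanced \<alpha> TYPE('g::{topological_group_add, polish_space})"
    and "\<not> unbalanced \<alpha> TYPE('h::{topological_group_add, polish_space})"
  shows "\<not> (E_rel :: (nat \<Rightarrow> 'g) \<Rightarrow> (nat \<Rightarrow> 'g) \<Rightarrow> bool) \<le>\<^sub>B (E_rel :: (nat \<Rightarrow> 'h) \<Rightarrow> (nat \<Rightarrow> 'h) \<Rightarrow> bool)"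
proof
  assume "(E_rel :: (nat \<Rightarrow> 'g) \<Rightarrow> (nat \<Rightarrow> 'g) \<Rightarrow> bool) \<le>\<^sub>B (E_rel :: (nat \<Rightarrow> 'h) \<Rightarrow> (nat \<Rightarrow> 'h) \<Rightarrow> bool)"
  then obtain f :: "(nat \<Rightarrow> 'g) \<Rightarrow> (nat \<Rightarrow> 'h)" where f: "f \<in> borel \<rightarrow>\<^sub>M borel"
    "\<And>x y. E_rel x y \<longleftrightarrow> E_rel (f x) (f y)"
    unfolding borel_reducible_def by blast
  obtain x y :: "nat \<Rightarrow> 'g" where xy: "usq cseq_topology (\<lambda>_. 0) cseq_act \<alpha> cseq x y" "\<not> E_rel x y"
    using assms(2) unfolding unbalanced_def by blast
  define a where "a g = cseq_act (seq g)" for g :: "'g conv_seq"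
  define b where "b h = cseq_act (seq h)" for h :: "'h conv_seq"
  have a: "continuous_action a" and b: "continuous_action b"
    unfolding a_def b_def by (rule continuous_action_conv_seq)+
  \<comment> \<open>\<open>E_rel\<close> is the orbit relation on both sides, so \<open>f\<close>
    sends orbits into orbits.\<close>
  have hom: "\<exists>h. f (a g x) = b h (f x)" for g x
  proof -
    have "E_rel (a g x) x"
      unfolding E_rel_iff_orbit a_def using seq by blast
    then obtain \<gamma> where "\<gamma> \<in> cseq" "f (a g x) = cseq_act \<gamma> (f x)"
      using f(2) E_rel_iff_orbit by blast
    then show ?thesis
      unfolding b_def by (metis Abs_conv_seq_inverse)
  qed
  have base: "\<exists>W1. open W1 \<and> 0 \<in> W1 \<and>
      {p. \<exists>w\<in>W1. fst p = b w (snd p)} \<in> sets borel \<and> (\<forall>v\<in>W1. \<forall>w\<in>W1. v - w \<in> W)"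
    if "open W" "0 \<in> W" for W
    using conv_seq_borel_orbit_base[OF that] unfolding b_def .
  obtain C where C: "\<forall>\<^sub>F x in residual. x \<in> C" "\<forall>x\<in>C. \<forall>\<^sub>F g in residual. a g x \<in> C"
    "\<forall>x\<in>C. \<forall>U. open U \<longrightarrow> f x \<in> U \<longrightarrow> (\<exists>T. open T \<and> x \<in> T \<and> (\<forall>y\<in>T \<inter> C. f y \<in> U))"
    "\<forall>x\<in>C. \<forall>W. open W \<longrightarrow> 0 \<in> W \<longrightarrow>
      (\<exists>T V. open T \<and> x \<in> T \<and> open V \<and> 0 \<in> V \<and> (\<forall>y\<in>T \<inter> C. orbit_bounded a b f V W y))"
    by (rule orbit_continuity[where a = a and b = b and f = f, OF a b f(1) hom base])
  have translate: "continuous_on UNIV (\<lambda>z n. u n + z n)" "continuous_on UNIV (\<lambda>z n. z n + u n)"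
    for u :: "nat \<Rightarrow> 'g"
    by (intro continuous_on_coordinatewise_then_product continuous_intros
        continuous_on_product_coordinates)+
  \<comment> \<open>For fixed \<open>u\<close>, left translation of \<open>z\<close> by
    \<open>u\<close> is a homeomorphism; so a generic \<open>z\<close> puts both translated points
    into \<open>C\<close>.\<close>
  have gen: "\<forall>\<^sub>F z in residual. (\<lambda>n. u n + z n) \<in> C" for u
    by (rule eventually_residual_homeomorphism[OF C(1), where \<psi> = "\<lambda>z n. - u n + z n"])
      (auto intro: translate simp: add.assoc[symmetric])
  obtain z where "(\<lambda>n. x n + z n) \<in> C \<and> (\<lambda>n. y n + z n) \<in> C"
    by (rule residual_Baire[OF eventually_conj[OF gen[of x] gen[of y]] open_UNIV UNIV_I])
  then have z: "(\<lambda>n. x n + z n) \<in> C" "(\<lambda>n. y n + z n) \<in> C"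
    by auto
  have "usq cseq_topology (\<lambda>_. 0) cseq_act \<alpha> cseq (\<lambda>n. x n + z n) (\<lambda>n. y n + z n)"
    by (rule usq_commuting_map[OF xy(1) translate(2)[of z]])
      (auto simp: cseq_act_def add.assoc topspace_cseq_topology)
  then have "usq euclidean 0 a \<alpha> UNIV (\<lambda>n. x n + z n) (\<lambda>n. y n + z n)"
    unfolding usq_cseq_iff a_def .
  \<comment> \<open>At the top level the neighbourhoods are the whole groups, and orbit boundedness
    is just \<open>hom\<close>.\<close>
  moreover have "orbit_bounded a b f UNIV UNIV u" for u
    unfolding orbit_bounded_def using hom by (simp add: always_eventually)
  ultimately have "usq euclidean 0 b \<alpha> UNIV (f (\<lambda>n. x n + z n)) (f (\<lambda>n. y n + z n))"
    using usq_orbit_continuous[OF a b C(2-4) z open_UNIV] by blast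
  then have "usq cseq_topology (\<lambda>_. 0) cseq_act \<alpha> cseq (f (\<lambda>n. x n + z n)) (f (\<lambda>n. y n + z n))"
    unfolding usq_cseq_iff b_def .
  \<comment> \<open>The factor \<open>z\<close> cancels in the termwise differences, so the
    translated points remain inequivalent, and the reduction preserves this.\<close>
  moreover have "\<not> E_rel (f (\<lambda>n. x n + z n)) (f (\<lambda>n. y n + z n))"
    unfolding f(2)[symmetric] using xy(2) by (simp add: E_rel_def diff_add_eq_diff_diff_swap)
  ultimately show False
    using assms(3) unfolding unbalanced_def by blast
qed

end
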